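(* Let $w=w(x_1,\dots,x_t)$ be a group-word and let $G$ be a profinite group. If the set of values $\{w(g_1,\dots,g_t) : g_1,\dots,g_t\in G\}$ has cardinality less than $2^{\aleph_0}$, then the verbal subgroup $w(w(G))$ is finite.
   Context: A group-word $w=w(x_1,\dots,x_t)$ is a nontrivial element of the free group on $x_1,\dots,x_t$, regarded as a function $G^t\to G$ on any group $G$; its values are the elements $w(g_1,\dots,g_t)$. For a profinite group $H$, $w(H)$ denotes the closed subgroup of $H$ topologically generated by all $w$-values in $H$. Thus $w(w(G))$ is the closed subgroup of $K=w(G)$ topologically generated by the $w$-values in $K$. *)

theory Defs
  imports "HOL-Analysis.Analysis" "HOL-Algebra.Algebra"
begin

definition topological_group :: "('a, 'b) monoid_scheme \<Rightarrow> 'a topology \<Rightarrow> bool" where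
  "topological_group G T \<longleftrightarrow> group G \<and> topspace T = carrier G
     \<and> continuous_map (prod_topology T T) T (\<lambda>(x, y). x \<otimes>\<^bsub>G\<^esub> y)
     \<and> continuous_map T T (\<lambda>x. inv\<^bsub>G\<^esub> x)"

definition totally_disconnected_space :: "'a topology \<Rightarrow> bool" where
  "totally_disconnected_space T \<longleftrightarrow>
     (\<forall>x \<in> topspace T. connected_component_of_set T x = {x})"

definition profinite_group :: "('a, 'b) monoid_scheme \<Rightarrow> 'a topology \<Rightarrow> bool" where
  "profinite_group G T \<longleftrightarrow> topological_group G T \<and> compact_space T
     \<and> Hausdorff_space T \<and> totally_disconnected_space T"

text \<open>A word in x_0, x_1, ... is a list of letters (i, e): (i, True) stands for x_i and
  (i, False) for x_i^{-1}. A word represents a nontrivial element of the free group iff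
  its free reduction is nonempty; we represent group-words by nonempty freely reduced
  words.\<close>
type_synonym word = "(nat \<times> bool) list"

fun reduced_word :: "word \<Rightarrow> bool" where
  "reduced_word ((i, b) # (j, c) # rest) \<longleftrightarrow>
     \<not> (i = j \<and> b \<noteq> c) \<and> reduced_word ((j, c) # rest)"
| "reduced_word _ \<longleftrightarrow> True"

definition group_word :: "nat \<Rightarrow> word \<Rightarrow> bool" where
  "group_word t w \<longleftrightarrow> w \<noteq> [] \<and> reduced_word w \<and> (\<forall>(i, b) \<in> set w. i < t)"

fun eval_word :: "('a, 'b) monoid_scheme \<Rightarrow> word \<Rightarrow> (nat \<Rightarrow> 'a) \<Rightarrow> 'a" where
  "eval_word G [] g = \<one>\<^bsub>G\<^esub>"
| "eval_word G ((i, b) # rest) g =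
     (if b then g i else inv\<^bsub>G\<^esub> (g i)) \<otimes>\<^bsub>G\<^esub> eval_word G rest g"

definition word_values :: "('a, 'b) monoid_scheme \<Rightarrow> nat \<Rightarrow> word \<Rightarrow> 'a set \<Rightarrow> 'a set" where
  "word_values G t w A = {eval_word G w g | g. \<forall>i < t. g i \<in> A}"

definition verbal_subgroup ::
    "('a, 'b) monoid_scheme \<Rightarrow> 'a topology \<Rightarrow> nat \<Rightarrow> word \<Rightarrow> 'a set \<Rightarrow> 'a set" where
  "verbal_subgroup G T t w H = T closure_of (generate G (word_values G t w H))"

end

theory Submission
  imports Defs
begin

text \<open>
  A continuous image of a compact space that has fewer than continuum many points has an isolated
  point, so the word map is constant on some nonempty open set. Applied to the conjugation action
  this shows that every w-value has an open centralizer, hence so does every element of the dense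
  abstract subgroup D of K = w(G) generated by the w-values. Applied to the word map on K, it
  yields a neighbourhood V of the identity in K on which w vanishes: the open set contains a tuple
  from D, and elements close to the identity commute with it.

  Now K is a union of finitely many translates aV with a in D. Let A be the normal closure of these
  elements a; its centralizer is open. If b centralizes A then w(acb) w(cb)^{-1} = w(ac) w(c)^{-1},
  so w(acb) = w(ac) whenever c and cb have entries in V. Hence w has only finitely many values on K,
  and each is attained on D.

  These values are torsion. If some exponent sum of w is nonzero, then K has only finitely many
  powers with that exponent, so K is torsion. Otherwise a value lies in a finitely generated
  subgroup of D, whose centre has finite index, and it is killed by the transfer into the centre.
  By Dietzmann's lemma the finite normal set of torsion w-values of K generates a finite group.
\<close>

section \<open>Evaluation of words\<close>

text \<open>These are the coordinates of the word in the abelianization of the free group. They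
  vanish together exactly for words in the commutator subgroup, and this separates the two torsion
  arguments.\<close>

fun exponent_sum :: "word \<Rightarrow> nat \<Rightarrow> int" where
  "exponent_sum [] j = 0"
| "exponent_sum ((i, b) # v) j = (if i = j then (if b then 1 else -1) else 0) + exponent_sum v j"

context group
begin

lemma inv_mult_cancel_left:
  assumes "x \<in> carrier G" "y \<in> carrier G"
  shows "inv x \<otimes> (x \<otimes> y) = y" "x \<otimes> (inv x \<otimes> y) = y"
  using assms by (simp_all add: m_assoc[symmetric])

lemma commute_inv:
  assumes "x \<in> carrier G" "y \<in> carrier G" "x \<otimes> y = y \<otimes> x"
  shows "inv x \<otimes> y = y \<otimes> inv x"
proof -
  have "inv x \<otimes> y = inv x \<otimes> (y \<otimes> x) \<otimes> inv x"
    using assms(1,2) by (simp add: m_assoc)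
  also have "\<dots> = y \<otimes> inv x"
    using assms(1,2) by (simp add: assms(3)[symmetric] inv_mult_cancel_left)
  finally show ?thesis .
qed

lemma eval_word_closed:
  assumes "\<And>i. i \<in> fst ` set v \<Longrightarrow> g i \<in> carrier G"
  shows "eval_word G v g \<in> carrier G"
  using assms by (induction v) auto

lemma eval_word_cong:
  assumes "\<And>i. i \<in> fst ` set v \<Longrightarrow> g i = h i"
  shows "eval_word G v g = eval_word G v h"
  using assms by (induction v) auto

lemma eval_word_conjugate:
  assumes "\<And>i. i \<in> fst ` set v \<Longrightarrow> g i \<in> carrier G" and x: "x \<in> carrier G"
  shows "eval_word G v (\<lambda>i. x \<otimes> g i \<otimes> inv x) = x \<otimes> eval_word G v g \<otimes> inv x"
  using assms(1)
proof (induction v)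
  case Nil
  then show ?case using x by simp
next
  case (Cons p v)
  obtain i b where p: "p = (i, b)" by force
  define a where "a = (if b then g i else inv (g i))"
  have gi: "g i \<in> carrier G" and a: "a \<in> carrier G"
    using Cons.prems p by (auto simp: a_def)
  have e: "eval_word G v g \<in> carrier G" using Cons.prems by (auto intro: eval_word_closed)
  have "(if b then x \<otimes> g i \<otimes> inv x else inv (x \<otimes> g i \<otimes> inv x)) = x \<otimes> a \<otimes> inv x"
    using gi x by (simp add: a_def inv_mult_group m_assoc)
  then show ?case
    using Cons e a x by (simp add: p a_def[symmetric] m_assoc inv_mult_cancel_left)
qed

text \<open>The letters from \<open>h\<close> move right past all letters from \<open>g\<close>.
  Only commutation between the two families matters: neither family has to be commutative in
  itself.\<close>

lemma eval_word_mult_commute: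
  assumes g: "\<And>i. i \<in> fst ` set v \<Longrightarrow> g i \<in> carrier G"
    and h: "\<And>i. i \<in> fst ` set v \<Longrightarrow> h i \<in> carrier G"
    and comm: "\<And>i j. i \<in> fst ` set v \<Longrightarrow> j \<in> fst ` set v \<Longrightarrow> g i \<otimes> h j = h j \<otimes> g i"
  shows "eval_word G v (\<lambda>i. g i \<otimes> h i) = eval_word G v g \<otimes> eval_word G v h"
proof -
  \<comment> \<open>The induction over words \<open>u\<close> in the variables of \<open>v\<close>
    also carries that every \<open>h j\<close> commutes with \<open>eval_word G u g\<close>; this
    lets the next letter from \<open>h\<close> pass.\<close>
  have "\<lbrakk>fst ` set u \<subseteq> fst ` set v\<rbrakk> \<Longrightarrow>
      eval_word G u (\<lambda>i. g i \<otimes> h i) = eval_word G u g \<otimes> eval_word G u h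
      \<and> (\<forall>j\<in>fst ` set v. h j \<otimes> eval_word G u g = eval_word G u g \<otimes> h j)" for u
  proof (induction u)
    case Nil
    then show ?case using h by simp
  next
    case (Cons p u)
    obtain i b where p: "p = (i, b)" by force
    define a where "a = (if b then g i else inv (g i))"
    define c where "c = (if b then h i else inv (h i))"
    have i: "i \<in> fst ` set v" using Cons.prems p by auto
    have sub: "j \<in> fst ` set v" if "j \<in> fst ` set u" for j using Cons.prems that by auto
    have car: "a \<in> carrier G" "c \<in> carrier G" "g i \<in> carrier G" "h i \<in> carrier G"
      using g[OF i] h[OF i] by (auto simp: a_def c_def)
    have e: "eval_word G u g \<in> carrier G" "eval_word G u h \<in> carrier G"
      by (auto intro!: eval_word_closed g h sub)
    have ga: "h j \<otimes> a = a \<otimes> h j" if "j \<in> fst ` set v" for j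
      using comm[OF i that] h[OF that] car by (auto simp: a_def commute_inv)
    have "(if b then g i \<otimes> h i else inv (g i \<otimes> h i)) = a \<otimes> c"
      using car by (simp add: a_def c_def comm[OF i i] inv_mult_group)
    moreover have IH: "eval_word G u (\<lambda>i. g i \<otimes> h i) = eval_word G u g \<otimes> eval_word G u h"
      and IH2: "\<And>j. j\<in>fst ` set v \<Longrightarrow> h j \<otimes> eval_word G u g = eval_word G u g \<otimes> h j"
      using Cons by auto
    moreover have "c \<otimes> eval_word G u g = eval_word G u g \<otimes> c"
      using IH2[OF i] car e by (auto simp: c_def commute_inv)
    then have "a \<otimes> c \<otimes> (eval_word G u g \<otimes> eval_word G u h)
        = a \<otimes> eval_word G u g \<otimes> (c \<otimes> eval_word G u h)"
      using car e by (simp add: m_assoc) (simp add: m_assoc[symmetric])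
    ultimately have "eval_word G (p # u) (\<lambda>i. g i \<otimes> h i)
        = eval_word G (p # u) g \<otimes> eval_word G (p # u) h"
      by (simp add: p a_def[symmetric] c_def[symmetric])
    moreover have "h j \<otimes> eval_word G (p # u) g = eval_word G (p # u) g \<otimes> h j"
      if "j \<in> fst ` set v" for j
    proof -
      have "h j \<otimes> (a \<otimes> eval_word G u g) = (h j \<otimes> a) \<otimes> eval_word G u g"
        using h[OF that] car e by (simp add: m_assoc)
      also have "\<dots> = a \<otimes> (h j \<otimes> eval_word G u g)"
        using h[OF that] car e by (simp add: ga[OF that] m_assoc)
      also have "\<dots> = a \<otimes> eval_word G u g \<otimes> h j"
        using h[OF that] car e by (simp add: IH2[OF that] m_assoc)
      finally show ?thesis by (simp add: p a_def[symmetric])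
    qed
    ultimately show ?case by blast
  qed
  then show ?thesis by blast
qed

lemma eval_word_single_variable:
  assumes x: "x \<in> carrier G"
  shows "eval_word G v (\<lambda>j. if j = i then x else \<one>) = x [^] exponent_sum v i"
proof (induction v)
  case (Cons p v)
  obtain j b where p: "p = (j, b)" by force
  show ?case using Cons x by (auto simp: p int_pow_mult int_pow_neg)
qed simp

lemma eval_word_subgroup:
  assumes "subgroup H G" and "\<And>i. i \<in> fst ` set v \<Longrightarrow> g i \<in> H"
  shows "eval_word (G\<lparr>carrier := H\<rparr>) v g = eval_word G v g"
  using assms(2) by (induction v) (auto simp: m_inv_consistent[OF assms(1)])

lemma eval_word_hom:
  assumes "group A" and f: "f \<in> hom G A" and "\<And>i. i \<in> fst ` set v \<Longrightarrow> g i \<in> carrier G"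
  shows "f (eval_word G v g) = eval_word A v (\<lambda>i. f (g i))"
proof -
  interpret h: group_hom G A f
    using assms(1) f by (simp add: group_hom_def group_hom_axioms_def group_axioms)
  show ?thesis using assms(3)
  proof (induction v)
    case (Cons p v)
    obtain i b where p: "p = (i, b)" by force
    have "eval_word G v g \<in> carrier G" using Cons.prems by (auto intro: eval_word_closed)
    then show ?case using Cons by (auto simp: p)
  qed simp
qed

text \<open>Moving the \<open>a i\<close> to the left conjugates them by elements of
  \<open>G\<close>, so they collect into one factor in the normal subgroup \<open>A\<close>. Each
  \<open>b i\<close> centralizes \<open>A\<close> and does not affect these conjugates; hence one
  \<alpha> serves both words.\<close>

lemma eval_word_mult_normal:
  assumes A: "A \<lhd> G"
    and a: "\<And>i. i \<in> fst ` set v \<Longrightarrow> a i \<in> A"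
    and x: "\<And>i. i \<in> fst ` set v \<Longrightarrow> x i \<in> carrier G"
    and b: "\<And>i. i \<in> fst ` set v \<Longrightarrow> b i \<in> carrier G"
    and comm: "\<And>i z. i \<in> fst ` set v \<Longrightarrow> z \<in> A \<Longrightarrow> b i \<otimes> z = z \<otimes> b i"
  shows "\<exists>\<alpha>\<in>A. eval_word G v (\<lambda>i. a i \<otimes> x i) = \<alpha> \<otimes> eval_word G v x
    \<and> eval_word G v (\<lambda>i. a i \<otimes> (x i \<otimes> b i)) = \<alpha> \<otimes> eval_word G v (\<lambda>i. x i \<otimes> b i)"
  using a x b comm
proof (induction v)
  case Nil
  interpret normal A G by fact
  show ?case by (intro bexI[of _ \<one>]) auto
next
  case (Cons p v)
  obtain i s where p: "p = (i, s)" by force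
  define E where "E = eval_word G v x"
  define E' where "E' = eval_word G v (\<lambda>i. x i \<otimes> b i)"
  have car [simp]: "x i \<in> carrier G" "b i \<in> carrier G" "E \<in> carrier G" "E' \<in> carrier G"
    using Cons.prems by (auto simp: p E_def E'_def intro!: eval_word_closed m_closed)
  interpret normal A G by fact
  have aA: "a i \<in> A" using Cons.prems by (simp add: p)
  have bz: "b i \<otimes> z = z \<otimes> b i" if "z \<in> A" for z using Cons.prems that by (simp add: p)
  have "\<exists>\<alpha>\<in>A. eval_word G v (\<lambda>i. a i \<otimes> x i) = \<alpha> \<otimes> E
    \<and> eval_word G v (\<lambda>i. a i \<otimes> (x i \<otimes> b i)) = \<alpha> \<otimes> E'"
    unfolding E_def E'_def by (rule Cons.IH) (use Cons.prems in auto)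
  then obtain \<alpha> where \<alpha>: "\<alpha> \<in> A" "eval_word G v (\<lambda>i. a i \<otimes> x i) = \<alpha> \<otimes> E"
    "eval_word G v (\<lambda>i. a i \<otimes> (x i \<otimes> b i)) = \<alpha> \<otimes> E'" by blast
  have [simp]: "a i \<in> carrier G" "\<alpha> \<in> carrier G" using aA \<alpha>(1) by auto
  show ?case
  proof (cases s)
    case True
    define \<beta> where "\<beta> = x i \<otimes> \<alpha> \<otimes> inv (x i)"
    have \<beta>: "\<beta> \<in> A" unfolding \<beta>_def by (rule inv_op_closed2) (use \<alpha> in auto)
    have [simp]: "\<beta> \<in> carrier G" using \<beta> by auto
    have 1: "x i \<otimes> \<alpha> = \<beta> \<otimes> x i" by (simp add: \<beta>_def m_assoc)
    have e1: "a i \<otimes> x i \<otimes> (\<alpha> \<otimes> E) = (a i \<otimes> \<beta>) \<otimes> (x i \<otimes> E)"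
    proof -
      have "a i \<otimes> x i \<otimes> (\<alpha> \<otimes> E) = a i \<otimes> (x i \<otimes> \<alpha>) \<otimes> E" by (simp add: m_assoc)
      then show ?thesis by (simp add: 1 m_assoc)
    qed
    have e2: "a i \<otimes> (x i \<otimes> b i) \<otimes> (\<alpha> \<otimes> E') = (a i \<otimes> \<beta>) \<otimes> (x i \<otimes> b i \<otimes> E')"
    proof -
      have "a i \<otimes> (x i \<otimes> b i) \<otimes> (\<alpha> \<otimes> E') = a i \<otimes> (x i \<otimes> (b i \<otimes> \<alpha>)) \<otimes> E'" by (simp add: m_assoc)
      also have "\<dots> = a i \<otimes> ((x i \<otimes> \<alpha>) \<otimes> b i) \<otimes> E'" by (simp add: bz[OF \<alpha>(1)] m_assoc)
      finally show ?thesis by (simp add: 1 m_assoc)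
    qed
    show ?thesis
      using e1 e2 \<alpha> \<beta> aA True
      by (intro bexI[of _ "a i \<otimes> \<beta>"]) (simp_all add: p E_def[symmetric] E'_def[symmetric])
  next
    case False
    \<comment> \<open>For an inverse letter, \<open>inv (a i)\<close> stands to the right of
      \<open>inv (x i)\<close>, so it is carried through \<open>inv (x i)\<close> together with
      \<alpha>.\<close>
    define \<beta> where "\<beta> = inv (x i) \<otimes> (inv (a i) \<otimes> \<alpha>) \<otimes> x i"
    have \<beta>: "\<beta> \<in> A" unfolding \<beta>_def by (rule inv_op_closed1) (use \<alpha> aA in auto)
    have [simp]: "\<beta> \<in> carrier G" using \<beta> by auto
    have 1: "inv (x i) \<otimes> (inv (a i) \<otimes> \<alpha>) = \<beta> \<otimes> inv (x i)" by (simp add: \<beta>_def m_assoc)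
    have 2: "inv (b i) \<otimes> \<beta> = \<beta> \<otimes> inv (b i)"
      using bz[OF \<beta>] by (simp add: commute_inv)
    have e1: "inv (a i \<otimes> x i) \<otimes> (\<alpha> \<otimes> E) = \<beta> \<otimes> (inv (x i) \<otimes> E)"
    proof -
      have "inv (a i \<otimes> x i) \<otimes> (\<alpha> \<otimes> E) = (inv (x i) \<otimes> (inv (a i) \<otimes> \<alpha>)) \<otimes> E"
        by (simp add: inv_mult_group m_assoc)
      then show ?thesis by (simp add: 1 m_assoc)
    qed
    have e2: "inv (a i \<otimes> (x i \<otimes> b i)) \<otimes> (\<alpha> \<otimes> E') = \<beta> \<otimes> (inv (x i \<otimes> b i) \<otimes> E')"
    proof -
      have "inv (a i \<otimes> (x i \<otimes> b i)) \<otimes> (\<alpha> \<otimes> E')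
          = inv (b i) \<otimes> (inv (x i) \<otimes> (inv (a i) \<otimes> \<alpha>)) \<otimes> E'"
        by (simp add: inv_mult_group m_assoc)
      also have "\<dots> = (inv (b i) \<otimes> \<beta>) \<otimes> (inv (x i) \<otimes> E')" by (simp add: 1 m_assoc)
      finally show ?thesis by (simp add: 2 inv_mult_group m_assoc)
    qed
    show ?thesis
      using e1 e2 \<alpha> \<beta> False
      by (intro bexI[of _ \<beta>]) (simp_all add: p E_def[symmetric] E'_def[symmetric])
  qed
qed

lemma word_values_closed:
  assumes "fst ` set w \<subseteq> {..<t}" "K \<subseteq> carrier G" "x \<in> word_values G t w K"
  shows "x \<in> carrier G"
  using assms by (auto simp: word_values_def image_subset_iff intro!: eval_word_closed)

lemma word_values_conjugate:
  assumes "fst ` set w \<subseteq> {..<t}" "K \<subseteq> carrier G" "\<And>k. k \<in> K \<Longrightarrow> g \<otimes> k \<otimes> inv g \<in> K"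
    and "g \<in> carrier G" "x \<in> word_values G t w K"
  shows "g \<otimes> x \<otimes> inv g \<in> word_values G t w K"
proof -
  obtain h where h: "x = eval_word G w h" "\<And>i. i < t \<Longrightarrow> h i \<in> K"
    using assms(5) by (auto simp: word_values_def)
  have "eval_word G w (\<lambda>i. g \<otimes> h i \<otimes> inv g) = g \<otimes> x \<otimes> inv g"
    unfolding h(1) using assms(1,2,4) h(2) by (intro eval_word_conjugate) (auto simp: image_subset_iff)
  then show ?thesis
    unfolding word_values_def using h assms(3)
    by (intro CollectI exI[of _ "\<lambda>i. g \<otimes> h i \<otimes> inv g"]) auto
qed

text \<open>Substituting \<open>x [^] k\<close> for the variable \<open>i\<close> and the identity
  for all others gives the value \<open>(x [^] k) [^] exponent_sum w i\<close>. With finitely many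
  values two of these powers coincide, and their quotient is a trivial power of
  \<open>x\<close>.\<close>

lemma torsion_if_finitely_many_word_values:
  assumes i: "exponent_sum w i \<noteq> 0" and K: "subgroup K G" and fin: "finite (word_values G t w K)"
    and x: "x \<in> K"
  shows "\<exists>n::nat. n > 0 \<and> x [^] n = \<one>"
proof -
  interpret K: subgroup K G by fact
  define e where "e = nat \<bar>exponent_sum w i\<bar>"
  have e: "e > 0" using i by (simp add: e_def)
  have abs_e: "\<bar>exponent_sum w i\<bar> = int e" by (simp add: e_def)
  have xc: "x \<in> carrier G" using x by auto
  have xK: "x [^] k \<in> K" for k :: nat using x by (induction k) auto
  have vals: "(x [^] k) [^] exponent_sum w i \<in> word_values G t w K" for k :: nat
    unfolding word_values_def using eval_word_single_variable[of "x [^] k" w i] xc xK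
    by (intro CollectI exI[of _ "\<lambda>j. if j = i then x [^] k else \<one>"]) auto
  have "\<not> inj (\<lambda>k::nat. (x [^] k) [^] exponent_sum w i)"
  proof
    assume "inj (\<lambda>k::nat. (x [^] k) [^] exponent_sum w i)"
    moreover have "range (\<lambda>k::nat. (x [^] k) [^] exponent_sum w i) \<subseteq> word_values G t w K"
      using vals by auto
    ultimately show False using fin finite_subset range_inj_infinite by blast
  qed
  then obtain k l :: nat where kl: "(x [^] k) [^] exponent_sum w i = (x [^] l) [^] exponent_sum w i" "k < l"
    by (metis (no_types, lifting) injI linorder_neqE_nat)
  \<comment> \<open>Passing to the absolute value replaces a possibly negative exponent by the
    natural number \<open>e\<close>.\<close>
  have abs: "y [^] \<bar>exponent_sum w i\<bar> = z [^] \<bar>exponent_sum w i\<bar>"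
    if "y [^] exponent_sum w i = z [^] exponent_sum w i" "y \<in> carrier G" "z \<in> carrier G" for y z
    using that by (auto simp: abs_if int_pow_neg)
  have "(x [^] k) [^] e = (x [^] l) [^] e"
    using abs[OF kl(1)] xc unfolding abs_e int_pow_int by simp
  then have "x [^] (k * e) = x [^] (l * e)" using xc by (simp add: nat_pow_pow)
  moreover have "l * e = (l - k) * e + k * e" using kl(2) by (metis add_mult_distrib le_add_diff_inverse2 less_imp_le)
  ultimately have "x [^] (k * e) = x [^] ((l - k) * e) \<otimes> x [^] (k * e)"
    using nat_pow_mult[OF xc, of "(l - k) * e" "k * e"] by metis
  then have "x [^] ((l - k) * e) = \<one>" using xc by simp
  then show ?thesis using kl(2) e by (intro exI[of _ "(l - k) * e"]) auto
qed

lemma centralizer_generate: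
  assumes S: "S \<subseteq> carrier G" and u: "u \<in> carrier G" "\<And>s. s \<in> S \<Longrightarrow> u \<otimes> s = s \<otimes> u"
    and z: "z \<in> generate G S"
  shows "u \<otimes> z = z \<otimes> u"
  using z
proof induction
  case (inv h)
  then show ?case using S u commute_inv[of h u] by auto
next
  case (eng h1 h2)
  have "h1 \<in> carrier G" "h2 \<in> carrier G" using eng generate_in_carrier[OF S] by auto
  then show ?case using eng u(1) by (metis m_assoc)
qed (use u in auto)

end

section \<open>Vanishing exponent sums and the transfer into the centre\<close>

lemma (in comm_group) eval_word_exponent_sums:
  assumes "finite I" "fst ` set v \<subseteq> I" and g: "g \<in> I \<rightarrow> carrier G"
  shows "eval_word G v g = (\<Otimes>i\<in>I. g i [^] exponent_sum v i)"
  using assms(2)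
proof (induction v)
  case (Cons p v)
  obtain j b where p: "p = (j, b)" by force
  define a where "a = (if b then g j else inv (g j))"
  have j: "j \<in> I" and gj: "g j \<in> carrier G" using Cons.prems p g by auto
  then have a: "a \<in> carrier G" by (simp add: a_def)
  have "(\<Otimes>i\<in>I. g i [^] exponent_sum (p # v) i)
      = (\<Otimes>i\<in>I. (if i = j then a else \<one>) \<otimes> g i [^] exponent_sum v i)"
    using g a by (intro finprod_cong') (auto simp: p a_def int_pow_mult int_pow_neg Pi_iff)
  also have "\<dots> = (\<Otimes>i\<in>I. if i = j then a else \<one>) \<otimes> (\<Otimes>i\<in>I. g i [^] exponent_sum v i)"
    using g a by (intro finprod_multf) (auto simp: Pi_iff)
  also have "(\<Otimes>i\<in>I. if i = j then a else \<one>) = a"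
    using finprod_singleton_swap[OF j assms(1), of "\<lambda>_. a"] a by simp
  finally show ?case using Cons by (simp add: p a_def)
qed simp

text \<open>The transfer into a central subgroup of finite index is a homomorphism to an abelian group,
  hence kills words with vanishing exponent sums, and restricts to a power map.\<close>
lemma (in group) eval_word_torsion_of_finite_index_centre:
  assumes Z: "subgroup Z G" and central: "\<And>z x. z \<in> Z \<Longrightarrow> x \<in> carrier G \<Longrightarrow> z \<otimes> x = x \<otimes> z"
    and fin: "finite (rcosets Z)"
    and g: "\<And>i. i \<in> fst ` set v \<Longrightarrow> g i \<in> carrier G"
    and zero: "\<And>i. i \<in> fst ` set v \<Longrightarrow> exponent_sum v i = 0"
  shows "\<exists>n::nat. n > 0 \<and> eval_word G v g [^] n = \<one>"
proof -
  interpret Z: subgroup Z G by fact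
  define A where "A = G\<lparr>carrier := Z\<rparr>"
  interpret A: comm_group A
    unfolding A_def using subgroup_imp_group[OF Z] central
    by (intro group.group_comm_groupI) (auto simp: Z.mem_carrier)
  have A_simps [simp]: "carrier A = Z" "x \<otimes>\<^bsub>A\<^esub> y = x \<otimes> y" "\<one>\<^bsub>A\<^esub> = \<one>" for x y
    by (auto simp: A_def)
  \<comment> \<open>The representative is chosen from the set \<open>Z #> x\<close>, so it depends
    only on the coset; \<open>c x\<close> is then the component of \<open>x\<close> in
    \<open>Z\<close>, with \<open>x = c x \<otimes> r x\<close>.\<close>
  define r where "r x = (SOME y. y \<in> Z #> x)" for x
  define c where "c x = x \<otimes> inv (r x)" for x
  have r: "r x \<in> Z #> x" if "x \<in> carrier G" for x
    unfolding r_def by (rule someI[of _ x]) (rule rcos_self[OF that Z])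
  have r_cl [simp]: "r x \<in> carrier G" if "x \<in> carrier G" for x
    using r[OF that] that r_coset_subset_G Z.subset by blast
  have c_Z [simp]: "c x \<in> Z" if x: "x \<in> carrier G" for x
  proof -
    obtain z where z: "z \<in> Z" "r x = z \<otimes> x" using r[OF x] by (auto simp: r_coset_def)
    then have "c x = inv z" using x Z.mem_carrier[OF z(1)]
      by (simp add: c_def inv_mult_group m_assoc[symmetric])
    then show ?thesis using z by simp
  qed
  have c_r: "c x \<otimes> r x = x" if "x \<in> carrier G" for x
    using that by (simp add: c_def m_assoc)
  have r_mult: "r (z \<otimes> x) = r x" if "z \<in> Z" "x \<in> carrier G" for z x
  proof -
    have "Z #> (z \<otimes> x) = Z #> x"
      using that coset_join2[of z Z] coset_mult_assoc[of Z z x] Z Z.subset by auto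
    then show ?thesis by (simp add: r_def)
  qed
  have r_r: "r (r x) = r x" if x: "x \<in> carrier G" for x
    using r_mult[of "c x" "r x"] c_r[OF x] x by simp
  have c_mult: "c (z \<otimes> x) = z \<otimes> c x" if "z \<in> Z" "x \<in> carrier G" for z x
    using that Z.mem_carrier[of z] by (simp add: c_def r_mult m_assoc)
  define R where "R = r ` carrier G"
  have R_sub: "t \<in> carrier G" and r_R: "r t = t" if "t \<in> R" for t
    using that r_r by (auto simp: R_def)
  have "R \<subseteq> (\<lambda>C. SOME y. y \<in> C) ` (rcosets Z)"
    using rcosetsI[OF Z.subset] by (auto simp: R_def r_def)
  then have finR: "finite R" using fin finite_surj by blast
  \<comment> \<open>The transfer: the product over all representatives \<open>t\<close> of the
    \<open>Z\<close>-component of \<open>t \<otimes> x\<close>, taken in the commutative group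
    \<open>A\<close>.\<close>
  define \<tau> where "\<tau> x = finprod A (\<lambda>t. c (t \<otimes> x)) R" for x
  have \<tau>_hom: "\<tau> \<in> hom G A"
  proof (rule homI)
    fix x assume "x \<in> carrier G"
    then show "\<tau> x \<in> carrier A"
      unfolding \<tau>_def using R_sub by (intro A.finprod_closed) auto
  next
    fix x y assume x: "x \<in> carrier G" and y: "y \<in> carrier G"
    \<comment> \<open>Right multiplication by \<open>x\<close> permutes the right cosets of
      \<open>Z\<close>; \<open>s\<close> is the induced permutation of representatives, and it
      reindexes the factor belonging to \<open>y\<close>.\<close>
    define s where "s t = r (t \<otimes> x)" for t
    have inj: "inj_on s R"
    proof
      fix t u assume t: "t \<in> R" and u: "u \<in> R" and eq: "s t = s u"
      define z where "z = c (t \<otimes> x) \<otimes> inv (c (u \<otimes> x))"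
      have z: "z \<in> Z" using R_sub t u x by (auto simp: z_def)
      have *: "t \<otimes> x = z \<otimes> (u \<otimes> x)"
      proof -
        have "z \<otimes> (u \<otimes> x) = z \<otimes> (c (u \<otimes> x) \<otimes> s u)"
          using c_r[of "u \<otimes> x"] R_sub u x by (simp add: s_def)
        also have "\<dots> = c (t \<otimes> x) \<otimes> s t"
          using R_sub t u x eq Z.mem_carrier[OF c_Z] by (simp add: z_def m_assoc s_def inv_solve_left')
        also have "\<dots> = t \<otimes> x" using c_r[of "t \<otimes> x"] R_sub t x by (simp add: s_def)
        finally show ?thesis by simp
      qed
      then have "t \<otimes> x = (z \<otimes> u) \<otimes> x"
        using R_sub u x Z.mem_carrier[OF z] by (simp add: m_assoc)
      then have "t = z \<otimes> u"
        using R_sub t u x Z.mem_carrier[OF z] by simp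
      then show "t = u" using r_mult[OF z R_sub[OF u]] r_R t u by simp
    qed
    have sR: "s ` R = R"
    proof (rule endo_inj_surj[OF finR _ inj])
      show "s ` R \<subseteq> R" using R_sub x by (auto simp: R_def s_def)
    qed
    have "\<tau> (x \<otimes> y) = finprod A (\<lambda>t. c (t \<otimes> x) \<otimes>\<^bsub>A\<^esub> c (s t \<otimes> y)) R"
      unfolding \<tau>_def
    proof (rule A.finprod_cong')
      fix t assume t: "t \<in> R"
      have "t \<otimes> (x \<otimes> y) = c (t \<otimes> x) \<otimes> (s t \<otimes> y)"
        using c_r[of "t \<otimes> x"] R_sub[OF t] x y Z.mem_carrier[OF c_Z]
        by (simp add: s_def m_assoc[symmetric])
      then show "c (t \<otimes> (x \<otimes> y)) = c (t \<otimes> x) \<otimes>\<^bsub>A\<^esub> c (s t \<otimes> y)"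
        using R_sub[OF t] x y by (simp add: c_mult s_def)
    qed (use R_sub x y in \<open>auto simp: s_def\<close>)
    also have "\<dots> = \<tau> x \<otimes>\<^bsub>A\<^esub> finprod A (\<lambda>t. c (s t \<otimes> y)) R"
      unfolding \<tau>_def using R_sub x y by (intro A.finprod_multf) (auto simp: s_def)
    also have "finprod A (\<lambda>t. c (s t \<otimes> y)) R = \<tau> y"
      unfolding \<tau>_def using A.finprod_reindex[of "\<lambda>t. c (t \<otimes> y)" s R] inj sR R_sub y by auto
    finally show "\<tau> (x \<otimes> y) = \<tau> x \<otimes>\<^bsub>A\<^esub> \<tau> y" .
  qed
  define n where "n = card R"
  have "R \<noteq> {}" by (auto simp: R_def)
  then have n: "n > 0" using finR by (simp add: n_def card_gt_0_iff)
  have pow_A: "x [^]\<^bsub>A\<^esub> k = x [^] k" for x and k :: nat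
    by (simp add: A_def nat_pow_def)
  have \<tau>_Z: "\<tau> z = z [^] n" if z: "z \<in> Z" for z
  proof -
    have "\<tau> z = finprod A (\<lambda>t. z) R"
      unfolding \<tau>_def
    proof (rule A.finprod_cong')
      fix t assume t: "t \<in> R"
      have "t \<otimes> z = z \<otimes> t" using central[OF z] R_sub[OF t] by simp
      then show "c (t \<otimes> z) = z"
        using c_mult[OF z R_sub[OF t]] r_R[OF t] R_sub[OF t] Z.mem_carrier[OF z]
        by (simp add: c_def)
    qed (use z in auto)
    then show ?thesis using z by (simp add: A.finprod_const pow_A n_def)
  qed
  interpret h: group_hom G A \<tau>
    using \<tau>_hom by (simp add: group_hom_def group_hom_axioms_def group_axioms A.group_axioms)
  define x where "x = eval_word G v g"
  have x: "x \<in> carrier G" using g by (auto simp: x_def intro: eval_word_closed)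
  have "\<tau> x = eval_word A v (\<lambda>i. \<tau> (g i))"
    unfolding x_def using A.group_axioms \<tau>_hom g by (rule eval_word_hom)
  also have "\<dots> = finprod A (\<lambda>i. \<tau> (g i) [^]\<^bsub>A\<^esub> exponent_sum v i) (fst ` set v)"
    using g h.hom_closed by (intro A.eval_word_exponent_sums) auto
  also have "\<dots> = \<one>\<^bsub>A\<^esub>"
    using zero g h.hom_closed by (intro A.finprod_one_eqI) auto
  finally have \<tau>x: "\<tau> x = \<one>\<^bsub>A\<^esub>" .
  \<comment> \<open>Among the powers of \<open>x\<close> two share a representative, so some
    \<open>x [^] m\<close> with \<open>m > 0\<close> lies in \<open>Z\<close>. There \<tau> is the
    \<open>n\<close>-th power map, while \<tau> is trivial on \<open>x\<close>.\<close>
  have "\<not> inj (\<lambda>k::nat. r (x [^] k))"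
  proof
    assume "inj (\<lambda>k::nat. r (x [^] k))"
    moreover have "range (\<lambda>k::nat. r (x [^] k)) \<subseteq> R" using x by (auto simp: R_def)
    ultimately show False using finR finite_subset range_inj_infinite by blast
  qed
  then obtain k l :: nat where kl: "r (x [^] k) = r (x [^] l)" "k < l"
    by (metis injI linorder_neqE_nat)
  define m where "m = l - k"
  have m: "m > 0" and l: "l = m + k" using kl by (auto simp: m_def)
  have "x [^] m = c (x [^] l) \<otimes> inv (c (x [^] k))"
  proof -
    have "x [^] m \<otimes> (c (x [^] k) \<otimes> r (x [^] k)) = c (x [^] l) \<otimes> r (x [^] k)"
      using c_r[of "x [^] k"] c_r[of "x [^] l"] x kl by (simp add: l nat_pow_mult)
    then have "(x [^] m \<otimes> c (x [^] k)) \<otimes> r (x [^] k) = c (x [^] l) \<otimes> r (x [^] k)"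
      using x Z.mem_carrier[OF c_Z] by (simp add: m_assoc)
    then have "x [^] m \<otimes> c (x [^] k) = c (x [^] l)"
      using x Z.mem_carrier[OF c_Z] by simp
    then show ?thesis using x Z.mem_carrier[OF c_Z] by (simp add: inv_solve_right)
  qed
  then have "x [^] m \<in> Z" using x by simp
  then have "(x [^] m) [^] n = \<tau> (x [^] m)" by (simp add: \<tau>_Z)
  also have "\<dots> = \<tau> x [^]\<^bsub>A\<^esub> m" using x by (simp add: h.hom_nat_pow)
  also have "\<dots> = \<one>" by (simp add: \<tau>x pow_A)
  finally have "x [^] (m * n) = \<one>" using x by (simp add: nat_pow_pow)
  then show ?thesis using m n x_def by (intro exI[of _ "m * n"]) auto
qed


section \<open>Products of lists and Dietzmann's lemma\<close>

context group
begin

lemma pow_commute_self: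
  fixes n :: nat
  assumes "x \<in> carrier G"
  shows "x \<otimes> x [^] n = x [^] n \<otimes> x"
  using assms nat_pow_Suc nat_pow_Suc2 by metis

definition list_prod :: "'a list \<Rightarrow> 'a" where
  "list_prod xs = foldr (\<otimes>) xs \<one>"

lemma list_prod_simps [simp]:
  "list_prod [] = \<one>" "list_prod (x # xs) = x \<otimes> list_prod xs"
  by (simp_all add: list_prod_def)

lemma list_prod_closed: "set xs \<subseteq> carrier G \<Longrightarrow> list_prod xs \<in> carrier G"
  by (induction xs) auto

lemma list_prod_append:
  "\<lbrakk>set xs \<subseteq> carrier G; set ys \<subseteq> carrier G\<rbrakk> \<Longrightarrow> list_prod (xs @ ys) = list_prod xs \<otimes> list_prod ys"
  by (induction xs) (auto simp: list_prod_closed m_assoc)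

lemma list_prod_replicate: "x \<in> carrier G \<Longrightarrow> list_prod (replicate n x) = x [^] n"
  by (induction n) (auto simp: pow_commute_self)

text \<open>Pulling the copies of \<open>x\<close> to the front conjugates the letters they pass.
  The conjugates remain in \<open>S\<close>, so the number of factors is preserved.\<close>

lemma list_prod_collect:
  assumes S: "S \<subseteq> carrier G" and conj: "\<And>g x. g \<in> carrier G \<Longrightarrow> x \<in> S \<Longrightarrow> g \<otimes> x \<otimes> inv g \<in> S"
    and x: "x \<in> S" and "set xs \<subseteq> S"
  shows "\<exists>ys. set ys \<subseteq> S \<and> length ys + count_list xs x = length xs
           \<and> list_prod xs = x [^] count_list xs x \<otimes> list_prod ys"
  using assms(4)
proof (induction xs)
  case Nil
  then show ?case by (intro exI[of _ "[]"]) auto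
next
  case (Cons y xs)
  then obtain ys where ys: "set ys \<subseteq> S" "length ys + count_list xs x = length xs"
    "list_prod xs = x [^] count_list xs x \<otimes> list_prod ys" by auto
  have car: "x \<in> carrier G" "y \<in> carrier G" "list_prod ys \<in> carrier G"
    using S x Cons.prems ys(1) by (auto intro!: list_prod_closed)
  show ?case
  proof (cases "y = x")
    case True
    then show ?thesis using ys car
      by (intro exI[of _ ys]) (simp add: m_assoc[symmetric] pow_commute_self)
  next
    case False
    define z where "z = x [^] count_list xs x"
    have z: "z \<in> carrier G" using car by (simp add: z_def)
    have "inv z \<otimes> y \<otimes> inv (inv z) \<in> S" using conj[of "inv z" y] z Cons.prems by simp
    moreover have "y \<otimes> (z \<otimes> list_prod ys) = z \<otimes> (inv z \<otimes> y \<otimes> inv (inv z) \<otimes> list_prod ys)"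
      using z car by (simp add: m_assoc inv_mult_cancel_left)
    ultimately show ?thesis using ys False
      by (intro exI[of _ "(inv z \<otimes> y \<otimes> inv (inv z)) # ys"]) (simp add: z_def[symmetric])
  qed
qed

text \<open>Dietzmann's lemma.\<close>
lemma finite_generate_normal_torsion:
  assumes fin: "finite S" and S: "S \<subseteq> carrier G"
    and conj: "\<And>g x. g \<in> carrier G \<Longrightarrow> x \<in> S \<Longrightarrow> g \<otimes> x \<otimes> inv g \<in> S"
    and torsion: "\<And>x. x \<in> S \<Longrightarrow> \<exists>n::nat. n > 0 \<and> x [^] n = \<one>"
  shows "finite (generate G S)"
proof -
  obtain e :: "'a \<Rightarrow> nat" where e: "\<And>x. x \<in> S \<Longrightarrow> e x > 0 \<and> x [^] e x = \<one>"
    using torsion by metis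
  define N where "N = (\<Sum>x\<in>S. e x)"
  define L where "L = {xs. set xs \<subseteq> S \<and> length xs \<le> N}"
  have short: "\<exists>ys\<in>L. list_prod xs = list_prod ys" if "set xs \<subseteq> S" for xs
    using that
  proof (induction "length xs" arbitrary: xs rule: less_induct)
    case less
    show ?case
    proof (cases "length xs \<le> N")
      case True
      then show ?thesis using less.prems by (auto simp: L_def)
    next
      case False
      have "(\<Sum>x\<in>S. count_list xs x) = length xs"
        using sum_count_set[OF less.prems fin] .
      then have "\<not> (\<forall>x\<in>S. count_list xs x \<le> e x)"
        using False sum_mono[of S "count_list xs" e] by (auto simp: N_def)
      then obtain x where x: "x \<in> S" "count_list xs x > e x" by force
      obtain ys where ys: "set ys \<subseteq> S" "length ys + count_list xs x = length xs"
        "list_prod xs = x [^] count_list xs x \<otimes> list_prod ys"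
        using list_prod_collect[OF S conj x(1) less.prems] by blast
      define k where "k = count_list xs x - e x"
      have xc: "x \<in> carrier G" using x S by auto
      have "x [^] count_list xs x = x [^] k \<otimes> x [^] e x"
        using xc x(2) by (simp add: k_def nat_pow_mult)
      then have "list_prod xs = list_prod (replicate k x @ ys)"
        using ys e[OF x(1)] xc S x(1)
        by (subst list_prod_append) (auto simp: list_prod_replicate)
      moreover have "length (replicate k x @ ys) < length xs"
        using ys(2) x(2) e[OF x(1)] unfolding k_def length_append length_replicate by linarith
      moreover have "set (replicate k x @ ys) \<subseteq> S" using x ys by auto
      ultimately show ?thesis using less.hyps by metis
    qed
  qed
  have "\<exists>xs. set xs \<subseteq> S \<and> h = list_prod xs" if "h \<in> generate G S" for h
    using that
  proof induction
    case one
    show ?case by (intro exI[of _ "[]"]) auto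
  next
    case (incl h)
    then show ?case using S by (intro exI[of _ "[h]"]) auto
  next
    case (inv h)
    have hc: "h \<in> carrier G" using inv S by auto
    \<comment> \<open>Torsion makes the inverse a nonnegative power, so lists over \<open>S\<close>
      alone reach the whole generated subgroup.\<close>
    obtain m where m: "e h = Suc m" using e[OF inv] by (cases "e h") auto
    then have "h [^] m \<otimes> h = \<one>" using e[OF inv] by simp
    then have "inv h = h [^] m" using hc by (simp add: inv_equality)
    then show ?case using inv hc
      by (intro exI[of _ "replicate m h"]) (auto simp: list_prod_replicate)
  next
    case (eng h1 h2)
    then obtain xs ys where "set xs \<subseteq> S" "h1 = list_prod xs" "set ys \<subseteq> S" "h2 = list_prod ys"
      by blast
    then show ?case using S by (intro exI[of _ "xs @ ys"]) (auto simp: list_prod_append)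
  qed
  then have "generate G S \<subseteq> list_prod ` L" using short by blast
  moreover have "finite L" unfolding L_def using fin by (rule finite_lists_length_le)
  ultimately show ?thesis using finite_subset by blast
qed

end

section \<open>Compact groups\<close>

text \<open>On \<open>P\<close> the map \<open>f\<close> factors through \<open>key\<close>. This is
  the counting device for word values and for cosets of a centre.\<close>

lemma finite_image_factor:
  assumes "finite (key ` P)" and "\<And>x y. \<lbrakk>x \<in> P; y \<in> P; key x = key y\<rbrakk> \<Longrightarrow> f x = f y"
  shows "finite (f ` P)"
proof (rule finite_surj[OF assms(1)])
  show "f ` P \<subseteq> (\<lambda>p. f (SOME x. x \<in> P \<and> key x = p)) ` key ` P"
  proof (clarsimp simp: image_image)
    fix x assume x: "x \<in> P"
    define y where "y = (SOME y. y \<in> P \<and> key y = key x)"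
    have "y \<in> P \<and> key y = key x"
      unfolding y_def by (rule someI[of _ x]) (use x in auto)
    then have "f x = f y" using assms(2) x by metis
    then show "f x \<in> (\<lambda>x. f (SOME xa. xa \<in> P \<and> key xa = key x)) ` P"
      unfolding y_def using x by blast
  qed
qed

lemma closure_meets_open:
  assumes "k \<in> Z closure_of D" "openin Z W" "k \<in> W"
  obtains d where "d \<in> D" "d \<in> W"
  using assms by (auto simp: in_closure_of)

text \<open>A nonempty perfect set in a locally compact Hausdorff space has at least continuum many
  points. The compact image is too small for that, so it has an isolated point \<open>y\<close>,
  whose preimage is open.\<close>

lemma locally_constant_if_image_small:
  assumes "compact_space P" "topspace P \<noteq> {}" "Hausdorff_space Y" and f: "continuous_map P Y f"
    and small: "\<not> (UNIV :: real set) \<lesssim> f ` topspace P"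
  obtains U y where "openin P U" "U \<noteq> {}" "\<And>x. x \<in> U \<Longrightarrow> f x = y"
proof -
  define S where "S = f ` topspace P"
  have S: "compactin Y S"
    unfolding S_def using assms(1) f image_compactin compact_space_def by blast
  define Z where "Z = subtopology Y S"
  have top: "topspace Z = S" unfolding Z_def using S compactin_subset_topspace by fastforce
  have "locally_compact_space Z" "Hausdorff_space Z"
    unfolding Z_def using S assms(3)
    by (auto intro!: compact_imp_locally_compact_space compact_space_subtopology Hausdorff_space_subtopology)
  then have "Z derived_set_of S \<noteq> S"
    using lepoll_perfect_set[of Z S] small assms(2) by (auto simp: S_def)
  moreover have "Z derived_set_of S \<subseteq> S"
    using derived_set_of_subset_topspace[of Z S] top by simp
  ultimately obtain y where y: "y \<in> S" "y \<notin> Z derived_set_of S" by blast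
  then obtain W where W: "openin Z W" "y \<in> W" "\<And>z. z \<in> S \<Longrightarrow> z \<in> W \<Longrightarrow> z = y"
    using top by (auto simp: in_derived_set_of)
  obtain W0 where W0: "openin Y W0" "W = W0 \<inter> S"
    using W(1) by (auto simp: Z_def openin_subtopology)
  show thesis
  proof
    show "openin P {x \<in> topspace P. f x \<in> W0}"
      using f W0(1) by (rule openin_continuous_map_preimage)
    show "{x \<in> topspace P. f x \<in> W0} \<noteq> {}"
      using y(1) W(2) unfolding W0(2) by (auto simp: S_def)
    show "f x = y" if "x \<in> {x \<in> topspace P. f x \<in> W0}" for x
      using that W(3)[of "f x"] W0 by (auto simp: S_def)
  qed
qed

section \<open>Compact Hausdorff groups and open centralizers\<close>

locale compact_group = group G for G :: "('a, 'b) monoid_scheme" (structure) +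
  fixes T :: "'a topology"
  assumes topspace [simp]: "topspace T = carrier G"
    and continuous_mult: "continuous_map (prod_topology T T) T (\<lambda>(x, y). x \<otimes> y)"
    and continuous_inv: "continuous_map T T (\<lambda>x. inv x)"
    and compact: "compact_space T"
    and Hausdorff: "Hausdorff_space T"
begin

lemma continuous_map_group_mult:
  assumes "continuous_map P T f" "continuous_map P T g"
  shows "continuous_map P T (\<lambda>x. f x \<otimes> g x)"
  using continuous_map_compose[OF continuous_map_pairedI[OF assms] continuous_mult]
  by (simp add: o_def)

lemma continuous_map_group_inv:
  assumes "continuous_map P T f"
  shows "continuous_map P T (\<lambda>x. inv (f x))"
  using continuous_map_compose[OF assms continuous_inv] by (simp add: o_def)

lemma openin_left_translate:
  assumes "a \<in> carrier G" "openin T U"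
  shows "openin T {x \<in> carrier G. a \<otimes> x \<in> U}"
proof -
  have "continuous_map T T (\<lambda>x. a \<otimes> x)"
    using assms(1) by (intro continuous_map_group_mult) (auto simp: continuous_map_id[unfolded id_def])
  from openin_continuous_map_preimage[OF this assms(2)] show ?thesis by simp
qed

text \<open>For \<open>k\<close> in the closure, the elements \<open>x\<close> with
  \<open>inv x \<otimes> k \<in> U\<close> form an open neighbourhood of \<open>k\<close>, which
  meets \<open>D\<close>. So the translates of \<open>U\<close> by elements of \<open>D\<close>
  itself cover the closure, and compactness leaves finitely many.\<close>

lemma closure_covered_by_translates:
  assumes D: "D \<subseteq> carrier G" and U: "openin T U" "\<one> \<in> U"
  obtains F where "finite F" "F \<subseteq> D" "\<And>k. k \<in> T closure_of D \<Longrightarrow> \<exists>d\<in>F. inv d \<otimes> k \<in> U"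
proof -
  define K where "K = T closure_of D"
  define N where "N d = {x \<in> carrier G. inv d \<otimes> x \<in> U}" for d
  have N: "openin T (N d)" if "d \<in> D" for d
    unfolding N_def using that D U by (intro openin_left_translate) auto
  have K: "compactin T K"
    unfolding K_def using compact by (intro closedin_compact_space) auto
  have cover: "K \<subseteq> \<Union> (N ` D)"
  proof
    fix k assume k: "k \<in> K"
    then have kc: "k \<in> carrier G" using compactin_subset_topspace[OF K] by auto
    have "continuous_map T T (\<lambda>x. inv x \<otimes> k)"
      using kc by (intro continuous_map_group_mult continuous_map_group_inv)
        (auto simp: continuous_map_id[unfolded id_def])
    from openin_continuous_map_preimage[OF this U(1)]
    have op: "openin T {x \<in> carrier G. inv x \<otimes> k \<in> U}" by simp
    obtain d where "d \<in> D" "inv d \<otimes> k \<in> U"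
      by (rule closure_meets_open[OF k[unfolded K_def] op]) (use kc U(2) in auto)
    then show "k \<in> \<Union> (N ` D)" using kc by (auto simp: N_def)
  qed
  obtain \<F> where \<F>: "finite \<F>" "\<F> \<subseteq> N ` D" "K \<subseteq> \<Union>\<F>"
    using compactinD[OF K _ cover] N by blast
  then obtain F where F: "F \<subseteq> D" "finite F" "\<F> = N ` F"
    using finite_subset_image[of \<F> N D] by blast
  show thesis
  proof
    show "\<exists>d\<in>F. inv d \<otimes> k \<in> U" if "k \<in> T closure_of D" for k
      using that \<F>(3) F by (force simp: K_def N_def)
  qed (use F in auto)
qed

lemma subgroup_closure:
  assumes D: "subgroup D G"
  shows "subgroup (T closure_of D) G"
proof -
  interpret D: subgroup D G by fact
  show ?thesis
  proof (rule subgroupI)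
    show "T closure_of D \<subseteq> carrier G" using closure_of_subset_topspace[of T D] by simp
    have "D \<subseteq> T closure_of D" using D.subset by (simp add: closure_of_subset)
    then show "T closure_of D \<noteq> {}" using D.one_closed by blast
    fix x assume x: "x \<in> T closure_of D"
    have "(\<lambda>x. inv x) ` (T closure_of D) \<subseteq> T closure_of ((\<lambda>x. inv x) ` D)"
      using continuous_inv by (rule continuous_map_image_closure_subset)
    also have "\<dots> \<subseteq> T closure_of D" by (rule closure_of_mono) auto
    finally show "inv x \<in> T closure_of D" using x by blast
    fix y assume y: "y \<in> T closure_of D"
    have "(\<lambda>(x, y). x \<otimes> y) ` (prod_topology T T closure_of (D \<times> D)) \<subseteq> T closure_of ((\<lambda>(x, y). x \<otimes> y) ` (D \<times> D))"
      using continuous_mult by (rule continuous_map_image_closure_subset)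
    also have "\<dots> \<subseteq> T closure_of D" by (rule closure_of_mono) auto
    finally show "x \<otimes> y \<in> T closure_of D" using x y by (force simp: closure_of_Times)
  qed
qed

lemma continuous_map_eval_word:
  assumes "fst ` set v \<subseteq> I" "K \<subseteq> carrier G"
  shows "continuous_map (product_topology (\<lambda>_. subtopology T K) I) T (eval_word G v)"
  using assms(1)
proof (induction v)
  case Nil
  then show ?case by simp
next
  case (Cons p v)
  obtain i b where p: "p = (i, b)" by force
  have i: "i \<in> I" using Cons.prems p by simp
  have "continuous_map (product_topology (\<lambda>_. subtopology T K) I) (subtopology T K) (\<lambda>x. x i)"
    using continuous_map_product_projection[OF i, of "\<lambda>_. subtopology T K"] .
  then have "continuous_map (product_topology (\<lambda>_. subtopology T K) I) T (\<lambda>x. x i)"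
    using continuous_map_into_fulltopology by blast
  then have "continuous_map (product_topology (\<lambda>_. subtopology T K) I) T
      (\<lambda>x. (if b then x i else inv (x i)) \<otimes> eval_word G v x)"
    using Cons by (cases b) (auto intro!: continuous_map_group_mult continuous_map_group_inv)
  moreover have "eval_word G (p # v) = (\<lambda>x. (if b then x i else inv (x i)) \<otimes> eval_word G v x)"
    by (auto simp: p)
  ultimately show ?case by simp
qed

text \<open>A subgroup containing a neighbourhood of the identity is open, so this expresses that
  the centralizer of \<open>x\<close> is open; \<open>U\<close> itself may be any neighbourhood, not
  just a subgroup.\<close>

definition open_centralizer :: "'a \<Rightarrow> bool" where
  "open_centralizer x \<longleftrightarrow>
     x \<in> carrier G \<and> (\<exists>U. openin T U \<and> \<one> \<in> U \<and> (\<forall>u\<in>U. u \<otimes> x = x \<otimes> u))"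

lemma open_centralizer_closed: "open_centralizer x \<Longrightarrow> x \<in> carrier G"
  by (simp add: open_centralizer_def)

lemma open_centralizer_mult:
  assumes "open_centralizer x" "open_centralizer y"
  shows "open_centralizer (x \<otimes> y)"
proof -
  obtain U V where U: "openin T U" "\<one> \<in> U" "\<forall>u\<in>U. u \<otimes> x = x \<otimes> u"
    and V: "openin T V" "\<one> \<in> V" "\<forall>u\<in>V. u \<otimes> y = y \<otimes> u"
    and xy: "x \<in> carrier G" "y \<in> carrier G"
    using assms by (auto simp: open_centralizer_def)
  have "u \<otimes> (x \<otimes> y) = x \<otimes> y \<otimes> u" if u: "u \<in> U \<inter> V" for u
  proof -
    have uc: "u \<in> carrier G" using u openin_subset[OF U(1)] by auto
    have "u \<otimes> (x \<otimes> y) = (u \<otimes> x) \<otimes> y" using uc xy by (simp add: m_assoc)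
    also have "\<dots> = x \<otimes> (u \<otimes> y)" using uc xy u U(3) by (simp add: m_assoc)
    also have "\<dots> = x \<otimes> y \<otimes> u" using uc xy u V(3) by (simp add: m_assoc)
    finally show ?thesis .
  qed
  then show ?thesis using U V xy unfolding open_centralizer_def
    by (intro conjI exI[of _ "U \<inter> V"]) auto
qed

lemma open_centralizer_inv:
  assumes "open_centralizer x"
  shows "open_centralizer (inv x)"
proof -
  obtain U where U: "openin T U" "\<one> \<in> U" "\<forall>u\<in>U. u \<otimes> x = x \<otimes> u" and x: "x \<in> carrier G"
    using assms by (auto simp: open_centralizer_def)
  have "u \<otimes> inv x = inv x \<otimes> u" if "u \<in> U" for u
    using that openin_subset[OF U(1)] U(3) x commute_inv[of x u] by auto
  then show ?thesis using U x unfolding open_centralizer_def by (intro conjI exI[of _ U]) auto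
qed

text \<open>The centralizer of a conjugate is the conjugate of the centralizer, and conjugation is
  continuous.\<close>

lemma open_centralizer_conjugate:
  assumes "open_centralizer x" and g: "g \<in> carrier G"
  shows "open_centralizer (g \<otimes> x \<otimes> inv g)"
proof -
  obtain U where U: "openin T U" "\<one> \<in> U" "\<forall>u\<in>U. u \<otimes> x = x \<otimes> u" and x: "x \<in> carrier G"
    using assms by (auto simp: open_centralizer_def)
  define V where "V = {u \<in> carrier G. inv g \<otimes> u \<otimes> g \<in> U}"
  have "continuous_map T T (\<lambda>u. inv g \<otimes> u \<otimes> g)"
    using g by (intro continuous_map_group_mult) (auto simp: continuous_map_id[unfolded id_def])
  from openin_continuous_map_preimage[OF this U(1)]
  have "openin T V" by (simp add: V_def)
  moreover have "\<one> \<in> V" using U(2) g by (simp add: V_def)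
  moreover have "u \<otimes> (g \<otimes> x \<otimes> inv g) = g \<otimes> x \<otimes> inv g \<otimes> u" if "u \<in> V" for u
  proof -
    define c where "c = inv g \<otimes> u \<otimes> g"
    have u: "u \<in> carrier G" and "c \<in> U" using that by (auto simp: V_def c_def)
    then have c: "c \<in> carrier G" "c \<otimes> x = x \<otimes> c" using U openin_subset[OF U(1)] by auto
    have ug: "u = g \<otimes> c \<otimes> inv g" using u g by (simp add: c_def m_assoc inv_mult_cancel_left)
    have "u \<otimes> (g \<otimes> x \<otimes> inv g) = g \<otimes> (c \<otimes> x) \<otimes> inv g"
      using g x c(1) by (simp add: ug m_assoc inv_mult_cancel_left)
    also have "\<dots> = g \<otimes> x \<otimes> inv g \<otimes> u"
      unfolding c(2) using g x c(1) by (simp add: ug m_assoc inv_mult_cancel_left)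
    finally show ?thesis .
  qed
  ultimately show ?thesis using g x unfolding open_centralizer_def by (intro conjI exI[of _ V]) auto
qed

lemma open_centralizer_generate:
  assumes "\<And>x. x \<in> S \<Longrightarrow> open_centralizer x" "x \<in> generate G S"
  shows "open_centralizer x"
  using assms(2)
proof induction
  case one
  show ?case unfolding open_centralizer_def
    using openin_topspace[of T] by (auto intro!: exI[of _ "carrier G"])
qed (auto intro: assms(1) open_centralizer_mult open_centralizer_inv)

text \<open>Intersecting finitely many neighbourhoods gives \<open>U\<close>, and compactness covers
  \<open>G\<close> by finitely many translates of \<open>U\<close>. This is finite index of the
  common centralizer in usable form: two elements in the same translate differ by some
  \<open>inv p \<otimes> q\<close> with \<open>p\<close>, \<open>q\<close> in \<open>U\<close>,
  which centralizes \<open>S\<close>.\<close>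

lemma finite_index_centralizer:
  assumes "finite S" "\<And>s. s \<in> S \<Longrightarrow> open_centralizer s"
  obtains U F where "openin T U" "\<one> \<in> U" "\<And>u s. u \<in> U \<Longrightarrow> s \<in> S \<Longrightarrow> u \<otimes> s = s \<otimes> u"
    "finite F" "F \<subseteq> carrier G" "\<And>g. g \<in> carrier G \<Longrightarrow> \<exists>f\<in>F. inv f \<otimes> g \<in> U"
proof -
  have "\<forall>s\<in>S. \<exists>U. openin T U \<and> \<one> \<in> U \<and> (\<forall>u\<in>U. u \<otimes> s = s \<otimes> u)"
    using assms(2) by (auto simp: open_centralizer_def)
  then obtain O' where O': "\<And>s. s \<in> S \<Longrightarrow> openin T (O' s) \<and> \<one> \<in> O' s \<and> (\<forall>u\<in>O' s. u \<otimes> s = s \<otimes> u)"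
    by metis
  \<comment> \<open>For empty \<open>S\<close> the intersection is the whole type;
    \<open>topspace T\<close> cuts it down to an open set.\<close>
  define U where "U = (\<Inter>s\<in>S. O' s) \<inter> topspace T"
  have U: "openin T U"
    unfolding U_def using assms(1) O' by (intro openin_INT) auto
  have U1: "\<one> \<in> U" unfolding U_def using O' by auto
  obtain F where F: "finite F" "F \<subseteq> carrier G"
    "\<And>k. k \<in> T closure_of (carrier G) \<Longrightarrow> \<exists>d\<in>F. inv d \<otimes> k \<in> U"
    using closure_covered_by_translates[OF subset_refl U U1] by blast
  have "T closure_of (carrier G) = carrier G" using closure_of_topspace[of T] by simp
  moreover have "u \<otimes> s = s \<otimes> u" if "u \<in> U" "s \<in> S" for u s
    using that O'[of s] by (auto simp: U_def)
  ultimately show thesis using that[OF U U1 _ F(1,2)] F(3) by auto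
qed

text \<open>If \<open>inv f \<otimes> g\<close> centralizes \<open>x\<close>, then \<open>f\<close>
  and \<open>g\<close> conjugate \<open>x\<close> to the same element, so finitely many
  \<open>f\<close> produce the whole class.\<close>

lemma finite_conjugacy_class:
  assumes "open_centralizer x"
  shows "finite {g \<otimes> x \<otimes> inv g | g. g \<in> carrier G}"
proof -
  have x: "x \<in> carrier G" using assms by (rule open_centralizer_closed)
  obtain U F where U: "openin T U" "\<one> \<in> U" "\<And>u s. u \<in> U \<Longrightarrow> s \<in> {x} \<Longrightarrow> u \<otimes> s = s \<otimes> u"
    and F: "finite F" "F \<subseteq> carrier G" "\<And>g. g \<in> carrier G \<Longrightarrow> \<exists>f\<in>F. inv f \<otimes> g \<in> U"
    by (rule finite_index_centralizer[of "{x}"]) (simp, use assms in simp, rule that)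
  have "{g \<otimes> x \<otimes> inv g | g. g \<in> carrier G} \<subseteq> (\<lambda>f. f \<otimes> x \<otimes> inv f) ` F"
  proof clarify
    fix g assume g: "g \<in> carrier G"
    then obtain f where f: "f \<in> F" "inv f \<otimes> g \<in> U" using F by blast
    define u where "u = inv f \<otimes> g"
    have fc: "f \<in> carrier G" and u: "u \<in> carrier G" "u \<otimes> x = x \<otimes> u"
      using f F U g by (auto simp: u_def)
    have gf: "g = f \<otimes> u" using fc g by (simp add: u_def inv_mult_cancel_left)
    have "g \<otimes> x \<otimes> inv g = f \<otimes> (u \<otimes> x) \<otimes> (inv u \<otimes> inv f)"
      using fc u(1) x by (simp add: gf inv_mult_group m_assoc)
    also have "\<dots> = f \<otimes> x \<otimes> inv f"
      unfolding u(2) using fc u(1) x by (simp add: m_assoc inv_mult_cancel_left)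
    finally show "g \<otimes> x \<otimes> inv g \<in> (\<lambda>f. f \<otimes> x \<otimes> inv f) ` F" using f by blast
  qed
  then show ?thesis using F(1) finite_surj by blast
qed

text \<open>Conjugates of a value are values, so \<open>g \<otimes> x \<otimes> inv g\<close> takes
  few values and is constant on a nonempty open set. Translating that set to the identity gives
  elements that fix \<open>x\<close> under conjugation.\<close>

lemma open_centralizer_word_value:
  assumes w: "fst ` set w \<subseteq> {..<t}"
    and small: "\<not> (UNIV :: real set) \<lesssim> word_values G t w (carrier G)"
    and x: "x \<in> word_values G t w (carrier G)"
  shows "open_centralizer x"
proof -
  have xc: "x \<in> carrier G" using word_values_closed[OF w _ x] by simp
  have cont: "continuous_map T T (\<lambda>g. g \<otimes> x \<otimes> inv g)"
    using xc by (intro continuous_map_group_mult continuous_map_group_inv)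
      (auto simp: continuous_map_id[unfolded id_def])
  have "(\<lambda>g. g \<otimes> x \<otimes> inv g) ` topspace T \<subseteq> word_values G t w (carrier G)"
    using word_values_conjugate[OF w _ _ _ x] by auto
  then have "\<not> (UNIV :: real set) \<lesssim> (\<lambda>g. g \<otimes> x \<otimes> inv g) ` topspace T"
    using small lepoll_trans subset_imp_lepoll by blast
  then obtain U y where U: "openin T U" "U \<noteq> {}" "\<And>g. g \<in> U \<Longrightarrow> g \<otimes> x \<otimes> inv g = y"
    using locally_constant_if_image_small[OF compact _ Hausdorff cont] by (metis carrier_not_empty topspace)
  obtain a where a: "a \<in> U" using U by blast
  have ac: "a \<in> carrier G" using a openin_subset[OF U(1)] by auto
  define V where "V = {u \<in> carrier G. a \<otimes> u \<in> U}"
  have "openin T V" unfolding V_def using ac U(1) by (rule openin_left_translate)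
  moreover have "\<one> \<in> V" using a ac by (simp add: V_def)
  moreover have "u \<otimes> x = x \<otimes> u" if "u \<in> V" for u
  proof -
    have u: "u \<in> carrier G" "a \<otimes> u \<in> U" using that by (auto simp: V_def)
    have "a \<otimes> u \<otimes> x \<otimes> inv (a \<otimes> u) = a \<otimes> x \<otimes> inv a" using U(3)[OF a] U(3)[OF u(2)] by simp
    then have "a \<otimes> (u \<otimes> x \<otimes> inv u) \<otimes> inv a = a \<otimes> x \<otimes> inv a"
      using ac u(1) xc by (simp add: inv_mult_group m_assoc)
    then have "u \<otimes> x \<otimes> inv u = x" using ac u(1) xc by simp
    then have "x \<otimes> u = u \<otimes> x \<otimes> inv u \<otimes> u" by simp
    also have "\<dots> = u \<otimes> x" using u(1) xc by (simp add: m_assoc)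
    finally show ?thesis by simp
  qed
  ultimately show ?thesis using xc unfolding open_centralizer_def by blast
qed

end

section \<open>The word map on the verbal subgroup\<close>

context compact_group
begin

text \<open>A nonempty open box on which the word is constant contains a tuple from the dense subgroup D.
  A neighbourhood of the identity commutes with that tuple, so translating back gives triviality.\<close>
lemma word_trivial_near_identity:
  assumes w: "fst ` set w \<subseteq> {..<t}" and D: "subgroup D G"
    and cent: "\<And>d. d \<in> D \<Longrightarrow> open_centralizer d"
    and small: "\<not> (UNIV :: real set) \<lesssim> word_values G t w (T closure_of D)"
  obtains V where "openin T V" "\<one> \<in> V"
    "\<And>n. (\<And>i. i < t \<Longrightarrow> n i \<in> V \<inter> T closure_of D) \<Longrightarrow> eval_word G w n = \<one>"
proof -
  interpret D: subgroup D G by fact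
  define K where "K = T closure_of D"
  interpret K: subgroup K G unfolding K_def using D by (rule subgroup_closure)
  have DK: "D \<subseteq> K" unfolding K_def using D.subset by (simp add: closure_of_subset)
  define P where "P = product_topology (\<lambda>_. subtopology T K) {..<t}"
  have topK: "topspace (subtopology T K) = K" using K.subset by auto
  have topP: "topspace P = PiE {..<t} (\<lambda>_. K)" by (simp only: P_def topspace_product_topology topK)
  have "compactin T K" unfolding K_def using compact by (intro closedin_compact_space) auto
  then have "compact_space P"
    unfolding P_def by (simp add: compact_space_product_topology compact_space_subtopology)
  moreover have "(\<lambda>i\<in>{..<t}. \<one>) \<in> topspace P" unfolding topP by auto
  then have "topspace P \<noteq> {}" by blast
  moreover have cont: "continuous_map P T (eval_word G w)"
    unfolding P_def using w K.subset by (rule continuous_map_eval_word)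
  moreover have "\<not> (UNIV :: real set) \<lesssim> eval_word G w ` topspace P"
  proof -
    have "eval_word G w ` topspace P \<subseteq> word_values G t w K"
      unfolding topP word_values_def by (auto simp: PiE_iff)
    then show ?thesis using small lepoll_trans subset_imp_lepoll unfolding K_def by blast
  qed
  ultimately obtain U y where U: "openin P U" "U \<noteq> {}" "\<And>x. x \<in> U \<Longrightarrow> eval_word G w x = y"
    using locally_constant_if_image_small[OF _ _ Hausdorff] by metis
  obtain x where "x \<in> U" using U(2) by blast
  then have "\<exists>B. finite {i \<in> {..<t}. B i \<noteq> topspace (subtopology T K)}
      \<and> (\<forall>i\<in>{..<t}. openin (subtopology T K) (B i)) \<and> x \<in> PiE {..<t} B \<and> PiE {..<t} B \<subseteq> U"
    using U(1) unfolding P_def openin_product_topology_alt by blast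
  then obtain B where B: "\<And>i. i < t \<Longrightarrow> openin (subtopology T K) (B i)"
    "x \<in> PiE {..<t} B" "PiE {..<t} B \<subseteq> U" by auto
  have "\<exists>W. openin T W \<and> B i = W \<inter> K" if "i < t" for i
    using B(1)[OF that] by (auto simp: openin_subtopology)
  then obtain W where W: "\<And>i. i < t \<Longrightarrow> openin T (W i)" "\<And>i. i < t \<Longrightarrow> B i = W i \<inter> K" by metis
  \<comment> \<open>Density of \<open>D\<close> in \<open>K\<close> supplies a tuple in the box
    whose entries have open centralizers.\<close>
  have "\<exists>h. h \<in> D \<and> h \<in> W i" if "i < t" for i
  proof -
    have "x i \<in> B i" using B(2) that by auto
    then have "x i \<in> T closure_of D" "x i \<in> W i" using W(2)[OF that] by (auto simp: K_def)
    then show ?thesis using closure_meets_open[OF _ W(1)[OF that]] by metis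
  qed
  then obtain h where h: "\<And>i. i < t \<Longrightarrow> h i \<in> D" "\<And>i. i < t \<Longrightarrow> h i \<in> W i" by metis
  \<comment> \<open>Points of the product are extensional functions, so an arbitrary tuple is first
    restricted to \<open>{..<t}\<close>; the word sees only these entries.\<close>
  have const: "eval_word G w g = y" if "\<And>i. i < t \<Longrightarrow> g i \<in> W i \<inter> K" for g
  proof -
    have "restrict g {..<t} \<in> PiE {..<t} B" using W(2) that by auto
    then have "restrict g {..<t} \<in> U" using B(3) by blast
    then have "eval_word G w (restrict g {..<t}) = y" by (rule U(3))
    moreover have "eval_word G w (restrict g {..<t}) = eval_word G w g"
      using w by (intro eval_word_cong) (auto simp: image_subset_iff)
    ultimately show ?thesis by simp
  qed
  obtain O' F where O': "openin T O'" "\<one> \<in> O'" "\<And>u s. u \<in> O' \<Longrightarrow> s \<in> h ` {..<t} \<Longrightarrow> u \<otimes> s = s \<otimes> u"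
    and "finite F" "F \<subseteq> carrier G" "\<And>g. g \<in> carrier G \<Longrightarrow> \<exists>f\<in>F. inv f \<otimes> g \<in> O'"
    by (rule finite_index_centralizer[of "h ` {..<t}"]) (simp, use cent h(1) in blast, rule that)
  \<comment> \<open>Entries from \<open>V\<close> keep \<open>h i \<otimes> n i\<close> in the box
    and commute with every \<open>h j\<close>. So the values at \<open>h\<close> and at the product
    tuple are both \<open>y\<close>, and cancelling leaves the value at \<open>n\<close>. The factor
    \<open>topspace T\<close> covers \<open>t = 0\<close>.\<close>
  define V where "V = (\<Inter>i\<in>{..<t}. {n \<in> carrier G. h i \<otimes> n \<in> W i}) \<inter> topspace T \<inter> O'"
  show thesis
  proof
    have "openin T {n \<in> carrier G. h i \<otimes> n \<in> W i}" if "i < t" for i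
      using that h W(1) D.subset by (intro openin_left_translate) auto
    then show "openin T V" unfolding V_def by (intro openin_Int openin_INT O') auto
    have "h i \<otimes> \<one> \<in> W i" if "i < t" for i using h[OF that] D.mem_carrier by simp
    then show "\<one> \<in> V" unfolding V_def using O'(2) by simp
    fix n assume n: "\<And>i. i < t \<Longrightarrow> n i \<in> V \<inter> T closure_of D"
    have nK: "n i \<in> K" and nV: "n i \<in> V" if "i < t" for i using n[OF that] by (auto simp: K_def)
    have hK: "h i \<in> K" if "i < t" for i using h(1)[OF that] DK by auto
    have i_t: "i < t" if "i \<in> fst ` set w" for i using that w by auto
    have "eval_word G w (\<lambda>i. h i \<otimes> n i) = y"
    proof (rule const)
      fix i assume i: "i < t"
      have "h i \<otimes> n i \<in> W i" using nV[OF i] i by (simp add: V_def)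
      then show "h i \<otimes> n i \<in> W i \<inter> K" using nK[OF i] hK[OF i] by simp
    qed
    moreover have "eval_word G w h = y" by (rule const) (use h hK in auto)
    moreover have "eval_word G w (\<lambda>i. h i \<otimes> n i) = eval_word G w h \<otimes> eval_word G w n"
    proof (rule eval_word_mult_commute)
      fix i j assume "i \<in> fst ` set w" "j \<in> fst ` set w"
      then have "i < t" "j < t" using i_t by auto
      then show "h i \<otimes> n j = n j \<otimes> h i" using O'(3)[of "n j" "h i"] nV[of j] by (simp add: V_def)
    qed (use i_t hK nK K.mem_carrier in auto)
    moreover have "eval_word G w h \<in> carrier G" "eval_word G w n \<in> carrier G"
      by (rule eval_word_closed; use i_t hK nK K.mem_carrier in blast)+
    ultimately show "eval_word G w n = \<one>" by simp
  qed
qed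

text \<open>The closure K of D is covered by finitely many translates aV with a in D, where the word is
  trivial on V. Its value at a tuple ac with c in V does not change when c moves within V inside a
  coset of the centralizer of the normal closure of the elements a, and this centralizer has finite
  index.\<close>
lemma finitely_many_word_values:
  assumes w: "fst ` set w \<subseteq> {..<t}" and D: "subgroup D G"
    and cent: "\<And>d. d \<in> D \<Longrightarrow> open_centralizer d"
    and small: "\<not> (UNIV :: real set) \<lesssim> word_values G t w (T closure_of D)"
  shows "finite (word_values G t w (T closure_of D))"
    and "word_values G t w (T closure_of D) \<subseteq> word_values G t w D"
proof -
  interpret D: subgroup D G by fact
  define K where "K = T closure_of D"
  interpret K: subgroup K G unfolding K_def using D by (rule subgroup_closure)
  have DK: "D \<subseteq> K" unfolding K_def using D.subset by (simp add: closure_of_subset)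
  obtain V where V: "openin T V" "\<one> \<in> V"
    and triv: "\<And>n. (\<And>i. i < t \<Longrightarrow> n i \<in> V \<inter> K) \<Longrightarrow> eval_word G w n = \<one>"
    using word_trivial_near_identity[OF w D cent small] unfolding K_def by metis
  obtain R where R: "finite R" "R \<subseteq> D" "\<And>k. k \<in> K \<Longrightarrow> \<exists>a\<in>R. inv a \<otimes> k \<in> V"
    unfolding K_def using closure_covered_by_translates[OF D.subset V] by metis
  have RK: "a \<in> K" if "a \<in> R" for a using that R(2) DK by blast
  \<comment> \<open>Each \<open>a\<close> in \<open>R\<close> has finitely many conjugates, so
    \<open>S\<close> is finite. Hence its centralizer, which is also that of the normal closure
    \<open>A\<close>, has finite index.\<close>
  define S where "S = (\<Union>a\<in>R. {g \<otimes> a \<otimes> inv g | g. g \<in> carrier G})"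
  have finS: "finite S" unfolding S_def using R cent finite_conjugacy_class by (intro finite_UN_I) auto
  have S: "open_centralizer s" if "s \<in> S" for s
    using that R(2) cent open_centralizer_conjugate by (auto simp: S_def)
  then have Sc: "S \<subseteq> carrier G" using open_centralizer_closed by auto
  have RS: "R \<subseteq> S"
  proof
    fix a assume a: "a \<in> R"
    then have "a = \<one> \<otimes> a \<otimes> inv \<one>" using K.mem_carrier[OF RK] by simp
    then show "a \<in> S" unfolding S_def using a by blast
  qed
  define A where "A = generate G S"
  have A: "A \<lhd> G" unfolding A_def
  proof (rule normal_generateI[OF Sc])
    fix s g assume "s \<in> S" and g: "g \<in> carrier G"
    then obtain a f where af: "a \<in> R" "f \<in> carrier G" "s = f \<otimes> a \<otimes> inv f" by (auto simp: S_def)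
    then have "g \<otimes> s \<otimes> inv g = (g \<otimes> f) \<otimes> a \<otimes> inv (g \<otimes> f)"
      using g K.mem_carrier[OF RK] by (simp add: inv_mult_group m_assoc)
    then show "g \<otimes> s \<otimes> inv g \<in> S" unfolding S_def using af g by blast
  qed
  obtain U F where U: "openin T U" "\<one> \<in> U" "\<And>u s. u \<in> U \<Longrightarrow> s \<in> S \<Longrightarrow> u \<otimes> s = s \<otimes> u"
    and F: "finite F" "F \<subseteq> carrier G" "\<And>g. g \<in> carrier G \<Longrightarrow> \<exists>f\<in>F. inv f \<otimes> g \<in> U"
    by (rule finite_index_centralizer[OF finS S]) (simp, rule that)
  define C where "C = {u \<in> carrier G. \<forall>z\<in>A. u \<otimes> z = z \<otimes> u}"
  have UC: "U \<subseteq> C"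
  proof
    fix u assume u: "u \<in> U"
    then have uc: "u \<in> carrier G" using openin_subset[OF U(1)] by auto
    have "u \<otimes> z = z \<otimes> u" if "z \<in> A" for z
      by (rule centralizer_generate[OF Sc uc U(3)[OF u]]) (use that A_def in auto)
    then show "u \<in> C" using uc unfolding C_def by blast
  qed
  \<comment> \<open>With \<open>b i = inv (c i) \<otimes> c' i\<close> both sides equal a common
    \<alpha> times the value at \<open>c\<close> or at \<open>c'\<close>; these two values are
    trivial because the entries lie in \<open>V\<close>.\<close>
  have key: "eval_word G w (\<lambda>i. a i \<otimes> c i) = eval_word G w (\<lambda>i. a i \<otimes> c' i)"
    if a: "\<And>i. i < t \<Longrightarrow> a i \<in> R" and c: "\<And>i. i < t \<Longrightarrow> c i \<in> V \<inter> K"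
      and c': "\<And>i. i < t \<Longrightarrow> c' i \<in> V \<inter> K" and C: "\<And>i. i < t \<Longrightarrow> inv (c i) \<otimes> c' i \<in> C" for a c c'
  proof -
    have i_t: "i < t" if "i \<in> fst ` set w" for i using that w by auto
    define b where "b i = inv (c i) \<otimes> c' i" for i
    have cc: "c i \<in> carrier G" "c' i \<in> carrier G" if "i < t" for i
      using c[OF that] c'[OF that] by auto
    have cb: "c i \<otimes> b i = c' i" if "i < t" for i
      using cc[OF that] by (simp add: b_def inv_mult_cancel_left)
    have "\<exists>\<alpha>\<in>A. eval_word G w (\<lambda>i. a i \<otimes> c i) = \<alpha> \<otimes> eval_word G w c
      \<and> eval_word G w (\<lambda>i. a i \<otimes> (c i \<otimes> b i)) = \<alpha> \<otimes> eval_word G w (\<lambda>i. c i \<otimes> b i)"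
    proof (rule eval_word_mult_normal[OF A])
      fix i assume "i \<in> fst ` set w"
      then have i: "i < t" by (rule i_t)
      show "a i \<in> A" using a[OF i] RS by (auto simp: A_def intro: generate.incl)
      show "c i \<in> carrier G" using cc i by simp
      show "b i \<in> carrier G" using cc[OF i] by (simp add: b_def)
      show "b i \<otimes> z = z \<otimes> b i" if "z \<in> A" for z
        using C[OF i] that by (simp add: C_def b_def)
    qed
    moreover have "eval_word G w (\<lambda>i. a i \<otimes> (c i \<otimes> b i)) = eval_word G w (\<lambda>i. a i \<otimes> c' i)"
      by (rule eval_word_cong) (use cb i_t in auto)
    moreover have "eval_word G w (\<lambda>i. c i \<otimes> b i) = eval_word G w c'"
      by (rule eval_word_cong) (use cb i_t in auto)
    moreover have "eval_word G w c = \<one>" using c by (rule triv)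
    moreover have "eval_word G w c' = \<one>" using c' by (rule triv)
    ultimately show ?thesis by force
  qed
  \<comment> \<open>Every \<open>k\<close> in \<open>K\<close> is split as
    \<open>k = \<rho> k \<otimes> \<gamma> k\<close> with a translating element
    \<rho>\<open>k\<close> in \<open>R\<close> and a remainder in \<open>V\<close>; \<phi> will
    select a translate of \<open>U\<close> containing a given element.\<close>
  obtain \<rho> where \<rho>: "\<And>k. k \<in> K \<Longrightarrow> \<rho> k \<in> R \<and> inv (\<rho> k) \<otimes> k \<in> V" using R(3) by metis
  define \<gamma> where "\<gamma> k = inv (\<rho> k) \<otimes> k" for k
  have \<gamma>: "\<gamma> k \<in> V \<inter> K" "\<rho> k \<otimes> \<gamma> k = k" "\<rho> k \<in> carrier G" if "k \<in> K" for k
    using \<rho>[OF that] RK[of "\<rho> k"] that by (auto simp: \<gamma>_def inv_mult_cancel_left)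
  have \<gamma>c: "\<gamma> k \<in> carrier G" if "k \<in> K" for k using \<gamma>(1)[OF that] by auto
  obtain \<phi> where \<phi>: "\<And>g. g \<in> carrier G \<Longrightarrow> \<phi> g \<in> F \<and> inv (\<phi> g) \<otimes> g \<in> U" using F(3) by metis
  have i_t: "i < t" if "i \<in> fst ` set w" for i using that w by auto
  have wv: "word_values G t w K = eval_word G w ` PiE {..<t} (\<lambda>_. K)"
  proof
    show "word_values G t w K \<subseteq> eval_word G w ` PiE {..<t} (\<lambda>_. K)"
    proof
      fix v assume "v \<in> word_values G t w K"
      then obtain g where g: "v = eval_word G w g" "\<forall>i<t. g i \<in> K" by (auto simp: word_values_def)
      have "eval_word G w g = eval_word G w (restrict g {..<t})"
        by (rule eval_word_cong) (use i_t in auto)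
      moreover have "restrict g {..<t} \<in> PiE {..<t} (\<lambda>_. K)" using g(2) by auto
      ultimately show "v \<in> eval_word G w ` PiE {..<t} (\<lambda>_. K)" using g(1) by blast
    qed
    show "eval_word G w ` PiE {..<t} (\<lambda>_. K) \<subseteq> word_values G t w K"
      by (auto simp: word_values_def PiE_iff)
  qed
  \<comment> \<open>For each entry the key records the translate of \<open>V\<close> and the
    translate of \<open>U\<close> holding the remainder. There are finitely many keys, and equal
    keys force equal values.\<close>
  define \<kappa> where "\<kappa> g = (\<lambda>i\<in>{..<t}. (\<rho> (g i), \<phi> (\<gamma> (g i))))" for g
  have "finite (eval_word G w ` PiE {..<t} (\<lambda>_. K))"
  proof (rule finite_image_factor)
    have "\<kappa> ` PiE {..<t} (\<lambda>_. K) \<subseteq> PiE {..<t} (\<lambda>_. R \<times> F)"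
    proof
      fix q assume "q \<in> \<kappa> ` PiE {..<t} (\<lambda>_. K)"
      then obtain g where g: "g \<in> PiE {..<t} (\<lambda>_. K)" "q = \<kappa> g" by blast
      have "(\<rho> (g i), \<phi> (\<gamma> (g i))) \<in> R \<times> F" if "i < t" for i
        using \<rho> \<phi> \<gamma>c g(1) that by (auto simp: PiE_iff)
      then show "q \<in> PiE {..<t} (\<lambda>_. R \<times> F)" by (auto simp: g(2) \<kappa>_def)
    qed
    then show "finite (\<kappa> ` PiE {..<t} (\<lambda>_. K))"
      using R(1) F(1) by (meson finite_PiE finite_SigmaI finite_lessThan finite_subset)
    fix g g' assume g: "g \<in> PiE {..<t} (\<lambda>_. K)" "g' \<in> PiE {..<t} (\<lambda>_. K)" and eq: "\<kappa> g = \<kappa> g'"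
    have gK: "g i \<in> K" "g' i \<in> K" if "i < t" for i using g that by auto
    have e: "\<rho> (g i) = \<rho> (g' i)" "\<phi> (\<gamma> (g i)) = \<phi> (\<gamma> (g' i))" if "i < t" for i
      using fun_cong[OF eq, of i] that by (auto simp: \<kappa>_def)
    have "eval_word G w (\<lambda>i. \<rho> (g i) \<otimes> \<gamma> (g i)) = eval_word G w (\<lambda>i. \<rho> (g i) \<otimes> \<gamma> (g' i))"
    proof (rule key)
      fix i assume i: "i < t"
      show "\<rho> (g i) \<in> R" using \<rho> gK[OF i] by simp
      show "\<gamma> (g i) \<in> V \<inter> K" "\<gamma> (g' i) \<in> V \<inter> K" using \<gamma>(1) gK[OF i] by auto
      define f where "f = \<phi> (\<gamma> (g i))"
      define c where "c = \<gamma> (g i)"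
      define c' where "c' = \<gamma> (g' i)"
      have cc: "c \<in> carrier G" "c' \<in> carrier G" using \<gamma>c gK[OF i] by (auto simp: c_def c'_def)
      have f: "f \<in> carrier G" "inv f \<otimes> c \<in> C" "inv f \<otimes> c' \<in> C"
        using \<phi>[OF cc(1)] \<phi>[OF cc(2)] F(2) UC e(2)[OF i] by (auto simp: f_def c_def c'_def)
      have "inv c \<otimes> c' = inv (inv f \<otimes> c) \<otimes> (inv f \<otimes> c')"
        using f(1) cc by (simp add: inv_mult_group m_assoc inv_mult_cancel_left)
      moreover have "inv (inv f \<otimes> c) \<otimes> (inv f \<otimes> c') \<in> C"
      proof -
        define p where "p = inv f \<otimes> c"
        define q where "q = inv f \<otimes> c'"
        have pq: "p \<in> carrier G" "q \<in> carrier G" using f by (auto simp: p_def q_def C_def)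
        have "inv p \<otimes> q \<otimes> z = z \<otimes> (inv p \<otimes> q)" if z: "z \<in> A" for z
        proof -
          have zc: "z \<in> carrier G" using z A normal_imp_subgroup subgroup.mem_carrier by metis
          have 1: "inv p \<otimes> z = z \<otimes> inv p"
            using f(2) z pq zc by (intro commute_inv) (auto simp: C_def p_def)
          have 2: "q \<otimes> z = z \<otimes> q" using f(3) z by (auto simp: C_def q_def)
          have "inv p \<otimes> q \<otimes> z = inv p \<otimes> (z \<otimes> q)" using pq zc by (simp add: m_assoc 2)
          also have "\<dots> = (inv p \<otimes> z) \<otimes> q" using pq zc by (simp add: m_assoc)
          also have "\<dots> = z \<otimes> (inv p \<otimes> q)" using pq zc by (simp add: 1 m_assoc)
          finally show ?thesis .
        qed
        then show ?thesis using pq unfolding C_def p_def q_def by blast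
      qed
      ultimately show "inv \<gamma> (g i) \<otimes> \<gamma> (g' i) \<in> C" by (simp add: c_def c'_def)
    qed
    moreover have "eval_word G w (\<lambda>i. \<rho> (g i) \<otimes> \<gamma> (g i)) = eval_word G w g"
      by (rule eval_word_cong) (use \<gamma>(2) gK i_t in auto)
    moreover have "eval_word G w (\<lambda>i. \<rho> (g i) \<otimes> \<gamma> (g' i)) = eval_word G w g'"
      by (rule eval_word_cong) (use \<gamma>(2) gK i_t e(1) in auto)
    ultimately show "eval_word G w g = eval_word G w g'" by simp
  qed
  then show "finite (word_values G t w (T closure_of D))" using wv by (simp add: K_def)
  show "word_values G t w (T closure_of D) \<subseteq> word_values G t w D"
  proof
    fix v assume "v \<in> word_values G t w (T closure_of D)"
    then obtain g where g: "v = eval_word G w g" "\<And>i. i < t \<Longrightarrow> g i \<in> K"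
      by (auto simp: word_values_def K_def)
    \<comment> \<open>Density provides \<open>d\<close> in \<open>D\<close> so close to
      \<open>g i\<close> that it lies in the same translate of \<open>V\<close> and its remainder
      differs from that of \<open>g i\<close> by an element centralizing \<open>A\<close>. Then
      \<open>key\<close> replaces \<open>g\<close> by \<open>d\<close>.\<close>
    have "\<exists>d\<in>D. inv (\<rho> (g i)) \<otimes> d \<in> V \<and> inv (\<gamma> (g i)) \<otimes> (inv (\<rho> (g i)) \<otimes> d) \<in> U" if "i < t" for i
    proof -
      define a where "a = \<rho> (g i)"
      define c where "c = \<gamma> (g i)"
      have ac: "a \<in> carrier G" "c \<in> carrier G" "a \<otimes> c = g i" "c \<in> V"
        using \<gamma> \<gamma>c g(2)[OF that] by (auto simp: a_def c_def)
      define W where "W = {x \<in> carrier G. inv a \<otimes> x \<in> V} \<inter> {x \<in> carrier G. inv (a \<otimes> c) \<otimes> x \<in> U}"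
      have "openin T W" unfolding W_def
        using ac(1,2) V(1) U(1) by (intro openin_Int openin_left_translate) auto
      moreover have "g i \<in> W"
        using ac U(2) by (simp add: W_def ac(3)[symmetric] inv_mult_cancel_left)
      moreover have "g i \<in> T closure_of D" using g(2)[OF that] by (simp add: K_def)
      ultimately obtain d where d: "d \<in> D" "d \<in> W" using closure_meets_open by metis
      have "inv c \<otimes> (inv a \<otimes> d) = inv (a \<otimes> c) \<otimes> d"
        using ac(1,2) D.mem_carrier[OF d(1)] by (simp add: inv_mult_group m_assoc)
      then show ?thesis using d by (auto simp: W_def a_def[symmetric] c_def[symmetric])
    qed
    then obtain d where d: "\<And>i. i < t \<Longrightarrow> d i \<in> D \<and> inv (\<rho> (g i)) \<otimes> d i \<in> V
        \<and> inv (\<gamma> (g i)) \<otimes> (inv (\<rho> (g i)) \<otimes> d i) \<in> U" by metis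
    have "eval_word G w (\<lambda>i. \<rho> (g i) \<otimes> \<gamma> (g i))
        = eval_word G w (\<lambda>i. \<rho> (g i) \<otimes> (inv (\<rho> (g i)) \<otimes> d i))"
    proof (rule key)
      fix i assume i: "i < t"
      show "\<rho> (g i) \<in> R" using \<rho> g(2)[OF i] by simp
      then have "\<rho> (g i) \<in> K" by (rule RK)
      then show "inv (\<rho> (g i)) \<otimes> d i \<in> V \<inter> K" using d[OF i] DK by auto
      show "\<gamma> (g i) \<in> V \<inter> K" using \<gamma>(1) g(2)[OF i] by auto
      show "inv (\<gamma> (g i)) \<otimes> (inv (\<rho> (g i)) \<otimes> d i) \<in> C" using d[OF i] UC by auto
    qed
    moreover have "eval_word G w (\<lambda>i. \<rho> (g i) \<otimes> \<gamma> (g i)) = eval_word G w g"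
      by (rule eval_word_cong) (use \<gamma>(2) g(2) i_t in auto)
    moreover have "eval_word G w (\<lambda>i. \<rho> (g i) \<otimes> (inv (\<rho> (g i)) \<otimes> d i)) = eval_word G w d"
      by (rule eval_word_cong) (use \<gamma>(3) g(2) i_t d D.mem_carrier inv_mult_cancel_left in auto)
    ultimately show "v \<in> word_values G t w D"
      using g(1) d by (auto simp: word_values_def)
  qed
qed

text \<open>Only finitely many \<open>g i\<close> occur, so their common centralizer has finite
  index. Its intersection with the subgroup \<open>H\<close> they generate is central in
  \<open>H\<close>, so the centre of \<open>H\<close> has finite index and the transfer argument
  applies there.\<close>

lemma open_centralizer_word_torsion:
  assumes g: "\<And>i. i \<in> fst ` set v \<Longrightarrow> open_centralizer (g i)"
    and zero: "\<And>i. i \<in> fst ` set v \<Longrightarrow> exponent_sum v i = 0"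
  shows "\<exists>n::nat. n > 0 \<and> eval_word G v g [^] n = \<one>"
proof -
  define S where "S = g ` fst ` set v"
  have S: "open_centralizer s" if "s \<in> S" for s using that g by (auto simp: S_def)
  then have Sc: "S \<subseteq> carrier G" using open_centralizer_closed by auto
  have finS: "finite S" by (simp add: S_def)
  define H where "H = generate G S"
  have H: "subgroup H G" unfolding H_def using Sc by (rule generate_is_subgroup)
  interpret H: subgroup H G by fact
  define GH where "GH = G\<lparr>carrier := H\<rparr>"
  interpret GH: group GH unfolding GH_def using H by (rule subgroup_imp_group)
  have GH_simps [simp]: "carrier GH = H" "x \<otimes>\<^bsub>GH\<^esub> y = x \<otimes> y" "\<one>\<^bsub>GH\<^esub> = \<one>" for x y
    by (auto simp: GH_def)
  have inv_GH: "inv\<^bsub>GH\<^esub> x = inv x" if "x \<in> H" for x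
    unfolding GH_def using H that by (rule m_inv_consistent)
  define Z where "Z = {z \<in> H. \<forall>x\<in>H. z \<otimes> x = x \<otimes> z}"
  have Z: "subgroup Z GH"
  proof (rule GH.subgroupI)
    show "Z \<subseteq> carrier GH" by (auto simp: Z_def)
    have "\<one> \<in> Z" by (auto simp: Z_def)
    then show "Z \<noteq> {}" by blast
    fix a assume a: "a \<in> Z"
    then have aH: "a \<in> H" by (simp add: Z_def)
    show "inv\<^bsub>GH\<^esub> a \<in> Z" using a unfolding inv_GH[OF aH] by (auto simp: Z_def intro!: commute_inv)
    fix b assume b: "b \<in> Z"
    have "a \<otimes> b \<otimes> x = x \<otimes> (a \<otimes> b)" if x: "x \<in> H" for x
    proof -
      have c: "a \<in> carrier G" "b \<in> carrier G" "x \<in> carrier G" using a b x by (auto simp: Z_def)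
      have "a \<otimes> b \<otimes> x = a \<otimes> (x \<otimes> b)" using b x c by (simp add: Z_def m_assoc)
      also have "\<dots> = (a \<otimes> x) \<otimes> b" using c by (simp add: m_assoc)
      also have "\<dots> = x \<otimes> (a \<otimes> b)" using a x c by (simp add: Z_def m_assoc)
      finally show ?thesis .
    qed
    moreover have "a \<otimes> b \<in> H" using aH b unfolding Z_def by blast
    ultimately show "a \<otimes>\<^bsub>GH\<^esub> b \<in> Z" unfolding Z_def GH_simps by blast
  qed
  obtain U F where U: "openin T U" "\<one> \<in> U" "\<And>u s. u \<in> U \<Longrightarrow> s \<in> S \<Longrightarrow> u \<otimes> s = s \<otimes> u"
    and F: "finite F" "F \<subseteq> carrier G" "\<And>x. x \<in> carrier G \<Longrightarrow> \<exists>f\<in>F. inv f \<otimes> x \<in> U"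
    by (rule finite_index_centralizer[OF finS S]) (simp, rule that)
  obtain \<phi> where \<phi>: "\<And>x. x \<in> carrier G \<Longrightarrow> \<phi> x \<in> F \<and> inv (\<phi> x) \<otimes> x \<in> U" using F(3) by metis
  have "finite ((\<lambda>x. Z #>\<^bsub>GH\<^esub> x) ` H)"
  proof (rule finite_image_factor)
    \<comment> \<open>The cover consists of left translates but the cosets of \<open>Z\<close> are
      right cosets, so \<open>x\<close> is classified through its inverse:
      \<open>x \<otimes> inv y\<close> then becomes \<open>inv p \<otimes> q\<close> with
      \<open>p\<close>, \<open>q\<close> in \<open>U\<close>.\<close>
    have "(\<lambda>x. \<phi> (inv x)) ` H \<subseteq> F" using \<phi> by auto
    then show "finite ((\<lambda>x. \<phi> (inv x)) ` H)" using F(1) finite_subset by blast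
    fix x y assume x: "x \<in> H" and y: "y \<in> H" and eq: "\<phi> (inv x) = \<phi> (inv y)"
    define f where "f = \<phi> (inv x)"
    define p where "p = inv f \<otimes> inv x"
    define q where "q = inv f \<otimes> inv y"
    have xc: "x \<in> carrier G" "y \<in> carrier G" using x y by auto
    then have f: "f \<in> carrier G" "p \<in> U" "q \<in> U"
      using \<phi>[of "inv x"] \<phi>[of "inv y"] F(2) eq by (auto simp: f_def p_def q_def)
    have pq: "p \<in> carrier G" "q \<in> carrier G" using xc f by (auto simp: p_def q_def)
    have comm: "p \<otimes> h = h \<otimes> p" "q \<otimes> h = h \<otimes> q" if "h \<in> H" for h
      using centralizer_generate[OF Sc pq(1)] centralizer_generate[OF Sc pq(2)] U(3) f that
      by (auto simp: H_def)
    have xy: "x \<otimes> inv y = inv p \<otimes> q"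
      using xc f(1) by (simp add: p_def q_def inv_mult_group m_assoc inv_mult_cancel_left)
    have "inv p \<otimes> q \<otimes> h = h \<otimes> (inv p \<otimes> q)" if h: "h \<in> H" for h
    proof -
      have hc: "h \<in> carrier G" using h by auto
      have "inv p \<otimes> q \<otimes> h = inv p \<otimes> (h \<otimes> q)" using pq hc comm(2)[OF h] by (simp add: m_assoc)
      also have "\<dots> = (inv p \<otimes> h) \<otimes> q" using pq hc by (simp add: m_assoc)
      also have "\<dots> = h \<otimes> (inv p \<otimes> q)"
        using pq hc comm(1)[OF h] by (simp add: commute_inv m_assoc)
      finally show ?thesis .
    qed
    then have "x \<otimes> inv y \<in> Z" using x y unfolding Z_def xy[symmetric] by auto
    then have "x \<in> Z #>\<^bsub>GH\<^esub> y"
      using xc by (auto simp: r_coset_def m_assoc intro!: bexI[of _ "x \<otimes> inv y"])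
    then show "Z #>\<^bsub>GH\<^esub> x = Z #>\<^bsub>GH\<^esub> y"
      using GH.repr_independence[of x Z y] Z y by simp
  qed
  moreover have "rcosets\<^bsub>GH\<^esub> Z = (\<lambda>x. Z #>\<^bsub>GH\<^esub> x) ` H" by (auto simp: RCOSETS_def)
  ultimately have "finite (rcosets\<^bsub>GH\<^esub> Z)" by simp
  moreover have gH: "g i \<in> H" if "i \<in> fst ` set v" for i
    using that by (auto simp: H_def S_def intro!: generate.incl)
  ultimately have "\<exists>n::nat. n > 0 \<and> eval_word GH v g [^]\<^bsub>GH\<^esub> n = \<one>\<^bsub>GH\<^esub>"
    by (intro GH.eval_word_torsion_of_finite_index_centre[OF Z]) (auto simp: Z_def zero)
  then obtain n :: nat where n: "n > 0" "eval_word GH v g [^]\<^bsub>GH\<^esub> n = \<one>\<^bsub>GH\<^esub>" by blast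
  have "eval_word GH v g = eval_word G v g"
    unfolding GH_def using H gH by (rule eval_word_subgroup)
  moreover have "x [^]\<^bsub>GH\<^esub> n = x [^] n" for x by (simp add: GH_def nat_pow_def)
  ultimately show ?thesis using n by auto
qed

section \<open>Finiteness of the iterated verbal subgroup\<close>

theorem finite_verbal_subgroup_of_verbal_subgroup:
  assumes w: "fst ` set w \<subseteq> {..<t}"
    and small: "\<not> (UNIV :: real set) \<lesssim> word_values G t w (carrier G)"
  shows "finite (verbal_subgroup G T t w (verbal_subgroup G T t w (carrier G)))"
proof -
  define D where "D = generate G (word_values G t w (carrier G))"
  have vals: "word_values G t w (carrier G) \<subseteq> carrier G" using word_values_closed[OF w] by auto
  have D: "subgroup D G" unfolding D_def using vals by (rule generate_is_subgroup)
  have cent: "open_centralizer d" if "d \<in> D" for d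
    using open_centralizer_generate[OF open_centralizer_word_value[OF w small]] that by (simp add: D_def)
  define K where "K = T closure_of D"
  have K: "subgroup K G" unfolding K_def using D by (rule subgroup_closure)
  have K_eq: "verbal_subgroup G T t w (carrier G) = K" by (simp add: verbal_subgroup_def K_def D_def)
  have D_normal: "D \<lhd> G" unfolding D_def
    by (rule normal_generateI[OF vals]) (rule word_values_conjugate[OF w], auto)
  have Kc: "K \<subseteq> carrier G" using K subgroup.subset by blast
  \<comment> \<open>Invariance of \<open>K\<close> under conjugation by all of \<open>G\<close>
    makes the set of values on \<open>K\<close> normal in \<open>G\<close>, as Dietzmann's lemma
    demands.\<close>
  have K_conj: "g \<otimes> k \<otimes> inv g \<in> K" if g: "g \<in> carrier G" and k: "k \<in> K" for g k
  proof -
    have "continuous_map T T (\<lambda>x. g \<otimes> x \<otimes> inv g)"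
      using g by (intro continuous_map_group_mult) (auto simp: continuous_map_id[unfolded id_def])
    then have "(\<lambda>x. g \<otimes> x \<otimes> inv g) ` (T closure_of D) \<subseteq> T closure_of ((\<lambda>x. g \<otimes> x \<otimes> inv g) ` D)"
      by (rule continuous_map_image_closure_subset)
    also have "\<dots> \<subseteq> T closure_of D"
      using normal.inv_op_closed2[OF D_normal g] by (intro closure_of_mono) auto
    finally show ?thesis using k by (auto simp: K_def)
  qed
  have "word_values G t w K \<subseteq> word_values G t w (carrier G)"
    using Kc by (auto simp: word_values_def)
  then have smallK: "\<not> (UNIV :: real set) \<lesssim> word_values G t w K"
    using small lepoll_trans subset_imp_lepoll by blast
  define S where "S = word_values G t w K"
  have finS: "finite S" and SD: "S \<subseteq> word_values G t w D"
    using finitely_many_word_values[OF w D cent] smallK by (auto simp: S_def K_def)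
  have Sc: "S \<subseteq> carrier G" unfolding S_def using word_values_closed[OF w Kc] by auto
  \<comment> \<open>If all exponent sums vanish, the value is written with entries in
    \<open>D\<close>, which have open centralizers. Otherwise every element of \<open>K\<close> is
    torsion, and the value itself lies in \<open>D\<close>, hence in \<open>K\<close>.\<close>
  have torsion: "\<exists>n::nat. n > 0 \<and> s [^] n = \<one>" if s: "s \<in> S" for s
  proof (cases "\<forall>i. exponent_sum w i = 0")
    case True
    obtain g where g: "s = eval_word G w g" "\<And>i. i < t \<Longrightarrow> g i \<in> D"
      using s SD by (auto simp: word_values_def)
    show ?thesis unfolding g(1)
      by (rule open_centralizer_word_torsion) (use True w g(2) cent in auto)
  next
    case False
    then obtain i where i: "exponent_sum w i \<noteq> 0" by blast
    obtain g where g: "s = eval_word G w g" "\<And>i. i < t \<Longrightarrow> g i \<in> D"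
      using s SD by (auto simp: word_values_def)
    have gD: "g j \<in> D" if "j \<in> fst ` set w" for j using that w g(2) by auto
    interpret D: group "G\<lparr>carrier := D\<rparr>" using D by (rule subgroup_imp_group)
    have "eval_word (G\<lparr>carrier := D\<rparr>) w g \<in> D" using D.eval_word_closed[of w g] gD by simp
    then have "s \<in> D" using eval_word_subgroup[OF D, of w g] gD g(1) by simp
    then have "s \<in> K" using closure_of_subset[of D T] subgroup.subset[OF D] by (auto simp: K_def)
    then show ?thesis using torsion_if_finitely_many_word_values[OF i K] finS by (simp add: S_def)
  qed
  have "finite (generate G S)"
    using finS Sc
  proof (rule finite_generate_normal_torsion)
    show "g \<otimes> s \<otimes> inv g \<in> S" if "g \<in> carrier G" "s \<in> S" for g s
      using word_values_conjugate[OF w Kc K_conj] that by (simp add: S_def)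
  qed (rule torsion)
  moreover have "generate G S \<subseteq> carrier G" using Sc by (rule generate_incl)
  \<comment> \<open>A finite set is closed in a Hausdorff space, so the closure in
    \<open>verbal_subgroup\<close> adds nothing.\<close>
  ultimately have "closedin T (generate G S)"
    using Hausdorff by (simp add: closedin_Hausdorff_finite)
  then have "verbal_subgroup G T t w K = generate G S"
    by (simp add: verbal_subgroup_def S_def closure_of_closedin)
  then show ?thesis using K_eq \<open>finite (generate G S)\<close> by simp
qed

end

theorem theorem1p1:
  fixes G :: "('a, 'b) monoid_scheme" and T :: "'a topology"
    and t :: nat and w :: word
  assumes "profinite_group G T"
    and "group_word t w"
    and "ordLess2 (card_of (word_values G t w (carrier G))) (card_of (UNIV :: real set))"
  shows "finite (verbal_subgroup G T t w (verbal_subgroup G T t w (carrier G)))"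
proof -
  interpret compact_group G T
    using assms(1) unfolding profinite_group_def topological_group_def
    by (intro compact_group.intro compact_group_axioms.intro) simp_all
  have "fst ` set w \<subseteq> {..<t}" using assms(2) by (auto simp: group_word_def)
  \<comment> \<open>Cardinality below the continuum is restated as the absence of an injection of
    the reals into the set of values.\<close>
  moreover have "\<not> (UNIV :: real set) \<lesssim> word_values G t w (carrier G)"
    using assms(3) not_ordLess_ordLeq by (auto simp: lepoll_def card_of_ordLeq)
  ultimately show ?thesis by (rule finite_verbal_subgroup_of_verbal_subgroup)
qed

end
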